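(* Let $\mu$ be a non-negative Radon measure on $\mathbb{R}^d$ and let $f\in\mathrm{BV}_{\mathrm{Lip}}(\mathbb{R}^d,\mu)$. Then the measures $|D_\mu f|_{C^\infty}$ and $|D_\mu f|_{\mathrm{Lip}}$ on $\mathbb{R}^d$ coincide.
   Context: For $\Omega\subseteq\mathbb{R}^d$ open, $\mathrm{LIP}_{loc}(\Omega)$ is the space of locally Lipschitz functions on $\Omega$ (Lipschitz on some ball around each point); $\mathrm{Lip}(f;E)$ is the Lipschitz constant of $f|_E$, and $\mathrm{lip}_a(f)(x):=\lim_{r\to0}\mathrm{Lip}(f;B_r(x))$ is the asymptotic Lipschitz constant. $\mathrm{BV}_{\mathrm{Lip}}(\mathbb{R}^d,\mu)$ is the set of $f\in L^1_\mu(\mathbb{R}^d)$ for which there is $(f_n)_n\subseteq\mathrm{LIP}_{loc}(\mathbb{R}^d)\cap L^1_\mu(\mathbb{R}^d)$ with $f_n\to f$ in $L^1_\mu(\mathbb{R}^d)$ and $\sup_n\int_{\mathbb{R}^d}\mathrm{lip}_a(f_n)\,d\mu<\infty$ (equivalently, such a sequence can be found among compactly supported Lipschitz functions). For $f\in\mathrm{BV}_{\mathrm{Lip}}(\mathbb{R}^d,\mu)$ and $\Omega$ open, set $$|D_\mu f|_{\mathrm{Lip}}(\Omega):=\inf\Big\{\liminf_n\int_\Omega\mathrm{lip}_a(f_n)\,d\mu:(f_n)_n\subseteq\mathrm{LIP}_{loc}(\Omega)\cap L^1_\mu(\Omega),\ f_n\to f\text{ in }L^1_\mu(\Omega)\Big\},$$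 $$|D_\mu f|_{C^\infty}(\Omega):=\inf\Big\{\liminf_n\int_\Omega|\nabla f_n|\,d\mu:(f_n)_n\subseteq C^\infty(\Omega)\cap L^1_\mu(\Omega),\ f_n\to f\text{ in }L^1_\mu(\Omega)\Big\}.$$ Both are extended to all Borel sets $B\subseteq\mathbb{R}^d$ as the infimum of the values on open sets $\Omega\supseteq B$; both extensions are finite Borel measures on $\mathbb{R}^d$. *)

theory Defs
  imports "HOL-Analysis.Analysis"
begin

definition radon_measure :: "'a::euclidean_space measure \<Rightarrow> bool" where
  "radon_measure \<mu> \<longleftrightarrow> sets \<mu> = sets borel \<and>
     (\<forall>K. compact K \<longrightarrow> emeasure \<mu> K < \<infinity>) \<and>
     (\<forall>B\<in>sets borel. emeasure \<mu> B = (SUP K\<in>{K. compact K \<and> K \<subseteq> B}. emeasure \<mu> K))"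


subsection \<open>Lipschitz functions\<close>

definition loc_lipschitz_on :: "'a::metric_space set \<Rightarrow> ('a \<Rightarrow> real) \<Rightarrow> bool" where
  "loc_lipschitz_on \<Omega> f \<longleftrightarrow> (\<forall>x\<in>\<Omega>. \<exists>r>0. \<exists>L. L-lipschitz_on (ball x r \<inter> \<Omega>) f)"

definition Lip_const :: "('a::metric_space \<Rightarrow> real) \<Rightarrow> 'a set \<Rightarrow> ennreal" where
  "Lip_const f E = (SUP x\<in>E. SUP y\<in>E - {x}. ennreal (\<bar>f x - f y\<bar> / dist x y))"

text \<open>Functions on an open set \<open>\<Omega>\<close> are total functions whose values outside \<open>\<Omega>\<close> are
  irrelevant: for \<open>x \<in> \<Omega>\<close> the following limit only involves balls contained in \<open>\<Omega>\<close>.\<close>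

definition lip_a :: "('a::metric_space \<Rightarrow> real) \<Rightarrow> 'a \<Rightarrow> ennreal" where
  "lip_a f x = Lim (at_right (0::real)) (\<lambda>r. Lip_const f (ball x r))"

lemma lipschitz_on_iff_Lip_const:
  "C-lipschitz_on E f \<longleftrightarrow> 0 \<le> C \<and> Lip_const f E \<le> ennreal C"
proof -
  have "ennreal (\<bar>f x - f y\<bar> / dist x y) \<le> ennreal C \<longleftrightarrow> \<bar>f x - f y\<bar> \<le> C * dist x y"
    if "x \<noteq> y" "0 \<le> C" for x y
    using that by (simp add: ennreal_le_iff divide_le_eq)
  then show ?thesis
    unfolding lipschitz_on_def Lip_const_def SUP_le_iff dist_real_def
    by (metis DiffE DiffI abs_0 diff_self dist_self empty_iff insertE insertI1 mult_zero_right
        order_refl)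
qed

lemma Lip_const_mono: "E \<subseteq> F \<Longrightarrow> Lip_const f E \<le> Lip_const f F"
  unfolding Lip_const_def by (intro SUP_mono' SUP_subset_mono) auto

text \<open>The limit defining \<open>lip_a\<close> always exists.\<close>

lemma tendsto_lip_a: "((\<lambda>r. Lip_const f (ball x r)) \<longlongrightarrow> lip_a f x) (at_right 0)"
proof -
  let ?g = "\<lambda>r. Lip_const f (ball x r)"
  have "(?g \<longlongrightarrow> (INF r\<in>{0<..}. ?g r)) (at_right 0)"
  proof (rule order_tendstoI)
    fix a assume a: "a < (INF r\<in>{0<..}. ?g r)"
    have "a < ?g r" if "r > 0" for r
      using a that by (meson INF_lower greaterThan_iff less_le_trans)
    then show "\<forall>\<^sub>F r in at_right 0. a < ?g r"
      by (auto simp: eventually_at_right_field intro: exI[of _ 1])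
  next
    fix a assume "(INF r\<in>{0<..}. ?g r) < a"
    then obtain s where s: "s > 0" "?g s < a"
      by (auto simp: INF_less_iff)
    have "?g r < a" if "r < s" for r
      using Lip_const_mono[of "ball x r" "ball x s" f] that s
      by (meson le_less_trans less_imp_le subset_ball)
    then show "\<forall>\<^sub>F r in at_right 0. ?g r < a"
      using s by (auto simp: eventually_at_right_field)
  qed
  then show ?thesis
    unfolding lip_a_def by (metis tendsto_Lim trivial_limit_at_right_real)
qed


subsection \<open>Smooth functions\<close>

primrec Ck_on :: "nat \<Rightarrow> 'a::euclidean_space set \<Rightarrow> ('a \<Rightarrow> real) \<Rightarrow> bool" where
  "Ck_on 0 \<Omega> f \<longleftrightarrow> continuous_on \<Omega> f"
| "Ck_on (Suc k) \<Omega> f \<longleftrightarrow> (\<forall>x\<in>\<Omega>. f differentiable (at x)) \<and>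
     (\<forall>v. Ck_on k \<Omega> (\<lambda>x. frechet_derivative f (at x) v))"

definition Cinf_on :: "'a::euclidean_space set \<Rightarrow> ('a \<Rightarrow> real) \<Rightarrow> bool" where
  "Cinf_on \<Omega> f \<longleftrightarrow> (\<forall>k. Ck_on k \<Omega> f)"

definition grad :: "('a::euclidean_space \<Rightarrow> real) \<Rightarrow> 'a \<Rightarrow> 'a" where
  "grad f x = (THE D. GDERIV f x :> D)"


subsection \<open>Total variation\<close>

definition L1_conv_on ::
  "'a::euclidean_space measure \<Rightarrow> 'a set \<Rightarrow> (nat \<Rightarrow> 'a \<Rightarrow> real) \<Rightarrow> ('a \<Rightarrow> real) \<Rightarrow> bool" where
  "L1_conv_on \<mu> \<Omega> F f \<longleftrightarrow> (\<lambda>n. \<integral>\<^sup>+x\<in>\<Omega>. ennreal \<bar>F n x - f x\<bar> \<partial>\<mu>) \<longlonglongrightarrow> 0"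

definition BV_Lip :: "'a::euclidean_space measure \<Rightarrow> ('a \<Rightarrow> real) set" where
  "BV_Lip \<mu> = {f. integrable \<mu> f \<and>
     (\<exists>F. (\<forall>n. loc_lipschitz_on UNIV (F n) \<and> integrable \<mu> (F n)) \<and>
          L1_conv_on \<mu> UNIV F f \<and> (SUP n. \<integral>\<^sup>+x. lip_a (F n) x \<partial>\<mu>) < \<infinity>)}"

definition var_Lip_open ::
  "'a::euclidean_space measure \<Rightarrow> ('a \<Rightarrow> real) \<Rightarrow> 'a set \<Rightarrow> ennreal" where
  "var_Lip_open \<mu> f \<Omega> =
     (INF F\<in>{F. (\<forall>n. loc_lipschitz_on \<Omega> (F n) \<and> set_integrable \<mu> \<Omega> (F n)) \<and>
                L1_conv_on \<mu> \<Omega> F f}.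
        liminf (\<lambda>n. \<integral>\<^sup>+x\<in>\<Omega>. lip_a (F n) x \<partial>\<mu>))"

definition var_Cinf_open ::
  "'a::euclidean_space measure \<Rightarrow> ('a \<Rightarrow> real) \<Rightarrow> 'a set \<Rightarrow> ennreal" where
  "var_Cinf_open \<mu> f \<Omega> =
     (INF F\<in>{F. (\<forall>n. Cinf_on \<Omega> (F n) \<and> set_integrable \<mu> \<Omega> (F n)) \<and>
                L1_conv_on \<mu> \<Omega> F f}.
        liminf (\<lambda>n. \<integral>\<^sup>+x\<in>\<Omega>. ennreal (norm (grad (F n) x)) \<partial>\<mu>))"

text \<open>The open-set functionals are monotone (restrict the competitors), so on open sets the
  extensions below agree with them.\<close>

definition var_Lip ::
  "'a::euclidean_space measure \<Rightarrow> ('a \<Rightarrow> real) \<Rightarrow> 'a set \<Rightarrow> ennreal" where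
  "var_Lip \<mu> f B = (INF \<Omega>\<in>{\<Omega>. open \<Omega> \<and> B \<subseteq> \<Omega>}. var_Lip_open \<mu> f \<Omega>)"

definition var_Cinf ::
  "'a::euclidean_space measure \<Rightarrow> ('a \<Rightarrow> real) \<Rightarrow> 'a set \<Rightarrow> ennreal" where
  "var_Cinf \<mu> f B = (INF \<Omega>\<in>{\<Omega>. open \<Omega> \<and> B \<subseteq> \<Omega>}. var_Cinf_open \<mu> f \<Omega>)"

end

theory Submission
  imports Defs
begin

text \<open>
  Both functionals agree on every open set \<open>\<Omega>\<close>. For smooth \<open>F\<close> one has \<open>lip_a F \<le> \<bar>\<nabla>F\<bar>\<close>, which
  gives one inequality. Conversely, a locally Lipschitz \<open>g\<close> is replaced by the Meyers--Serrin type
  sum \<open>h = \<Sum>\<^sub>n \<phi>\<^sub>n \<gamma>\<^sub>n\<close>, where \<open>\<phi>\<^sub>n\<close> is a smooth partition of unity on \<open>\<Omega>\<close> and \<open>\<gamma>\<^sub>n\<close> a mollification of \<open>g\<close>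
  at a small scale \<open>e\<^sub>n\<close>. Since \<open>\<Sum>\<^sub>n \<nabla>\<phi>\<^sub>n = 0\<close>, the gradient of \<open>h\<close> is
  \<open>\<Sum>\<^sub>n \<phi>\<^sub>n \<nabla>\<gamma>\<^sub>n + \<Sum>\<^sub>n (\<gamma>\<^sub>n - g) \<nabla>\<phi>\<^sub>n\<close>. The second sum is small because \<open>\<gamma>\<^sub>n\<close> is uniformly close to \<open>g\<close> on
  the support of \<open>\<phi>\<^sub>n\<close>; in the first, \<open>\<bar>\<nabla>\<gamma>\<^sub>n(x)\<bar>\<close> is at most the Lipschitz constant of \<open>g\<close> on the ball of
  radius \<open>2 e\<^sub>n\<close> around \<open>x\<close>, which decreases to \<open>lip_a g x\<close> as \<open>e\<^sub>n \<rightarrow> 0\<close>, boundedly on compact sets.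
\<close>

section \<open>Calculus of smooth functions\<close>

lemma GDERIV_unique:
  assumes "GDERIV f x :> D" "GDERIV f x :> D'"
  shows "D = D'"
proof -
  have "(\<lambda>h. inner h D) = (\<lambda>h. inner h D')"
    using assms unfolding gderiv_def by (rule has_derivative_unique)
  then have "inner (D - D') D = inner (D - D') D'" by (rule fun_cong)
  then have "inner (D - D') (D - D') = 0" by (simp add: inner_diff_right)
  then show ?thesis by simp
qed

lemma grad_eq: "GDERIV f x :> D \<Longrightarrow> grad f x = D"
  unfolding grad_def using GDERIV_unique by blast

lemma GDERIV_grad:
  fixes f :: "'a::euclidean_space \<Rightarrow> real"
  assumes "f differentiable (at x)"
  shows "GDERIV f x :> grad f x"
proof -
  obtain f' where f': "(f has_derivative f') (at x)"
    using assms differentiable_def by blast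
  have lin: "linear f'" using f' has_derivative_linear by blast
  define D where "D = (\<Sum>b\<in>Basis. f' b *\<^sub>R b)"
  have "f' h = inner h D" for h
  proof -
    have "f' h = f' (\<Sum>b\<in>Basis. inner h b *\<^sub>R b)" by (simp add: euclidean_representation)
    also have "\<dots> = inner h D"
      unfolding D_def inner_sum_right linear_sum[OF lin]
      by (simp only: linear_scale[OF lin] inner_scaleR_right real_scaleR_def mult.commute)
    finally show ?thesis .
  qed
  then have "f' = (\<lambda>h. inner h D)" by (rule ext)
  then have "GDERIV f x :> D" using f' by (simp add: gderiv_def)
  then show ?thesis using grad_eq by metis
qed

lemma frechet_derivative_eq_grad:
  fixes f :: "'a::euclidean_space \<Rightarrow> real"
  assumes "f differentiable (at x)"
  shows "frechet_derivative f (at x) v = inner v (grad f x)"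
proof -
  have "(\<lambda>h. inner h (grad f x)) = frechet_derivative f (at x)"
    using GDERIV_grad[OF assms] unfolding gderiv_def by (rule frechet_derivative_at)
  then show ?thesis by metis
qed

section \<open>Locality and algebra of the classes of smooth functions\<close>

lemma GDERIV_transform_open:
  assumes "GDERIV f x :> D" "open S" "x \<in> S" "\<And>y. y \<in> S \<Longrightarrow> f y = g y"
  shows "GDERIV g x :> D"
  using assms unfolding gderiv_def by (rule has_derivative_transform_within_open)

lemma differentiable_GDERIV: "GDERIV f x :> D \<Longrightarrow> f differentiable (at x)"
  unfolding gderiv_def differentiable_def by blast

text \<open>Derivatives at points of an open set depend only on values in that set, so total
  functions may be changed freely outside it.\<close>

lemma Ck_on_cong:
  assumes "open S" "\<And>x. x \<in> S \<Longrightarrow> f x = g x" "Ck_on k S f"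
  shows "Ck_on k S g"
  using assms(2,3)
proof (induction k arbitrary: f g)
  case 0
  then show ?case using continuous_on_cong by (metis Ck_on.simps(1))
next
  case (Suc k)
  have d: "GDERIV g x :> grad f x" if "x \<in> S" for x
    using Suc.prems that assms(1) by (intro GDERIV_transform_open[OF GDERIV_grad]) auto
  have eq: "frechet_derivative f (at x) v = frechet_derivative g (at x) v" if "x \<in> S" for x v
    using d[OF that] Suc.prems(2) that
    by (simp add: frechet_derivative_eq_grad differentiable_GDERIV[OF d] grad_eq[OF d])
  show ?case
    using Suc.prems(2) d differentiable_GDERIV Suc.IH[OF eq] by fastforce
qed

text \<open>Trades the \<open>frechet_derivative\<close> of the recursion for \<open>grad\<close>,
  the form in which the sum and product rules run by induction on \<open>k\<close>.\<close>

lemma Ck_on_Suc_iff: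
  assumes "open S"
  shows "Ck_on (Suc k) S f \<longleftrightarrow>
    (\<forall>x\<in>S. f differentiable (at x)) \<and> (\<forall>v. Ck_on k S (\<lambda>x. inner v (grad f x)))"
proof (cases "\<forall>x\<in>S. f differentiable (at x)")
  case True
  then have "Ck_on k S (\<lambda>x. frechet_derivative f (at x) v)
      \<longleftrightarrow> Ck_on k S (\<lambda>x. inner v (grad f x))" for v
    using Ck_on_cong[OF assms] by (smt (verit) frechet_derivative_eq_grad)
  then show ?thesis using True by simp
qed auto

lemma Ck_on_SucI:
  assumes "open S" "\<And>x. x \<in> S \<Longrightarrow> GDERIV f x :> D x" "\<And>v. Ck_on k S (\<lambda>x. inner v (D x))"
  shows "Ck_on (Suc k) S f"
proof -
  have "Ck_on k S (\<lambda>x. inner v (grad f x))" for v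
    by (rule Ck_on_cong[OF assms(1) _ assms(3)[of v]]) (metis assms(2) grad_eq)
  then show ?thesis
    using assms(2) by (auto simp: Ck_on_Suc_iff[OF assms(1)] simp del: Ck_on.simps intro: differentiable_GDERIV)
qed

lemma Ck_on_SucD: "Ck_on (Suc k) S f \<Longrightarrow> Ck_on k S f"
proof (induction k arbitrary: f)
  case 0
  then show ?case
    by (auto intro!: continuous_at_imp_continuous_on differentiable_imp_continuous_within)
next
  case (Suc k)
  then show ?case by (metis Ck_on.simps(2))
qed

lemma Ck_on_subset: "Ck_on k S f \<Longrightarrow> T \<subseteq> S \<Longrightarrow> Ck_on k T f"
  by (induction k arbitrary: f) (auto intro: continuous_on_subset)

text \<open>Every clause of \<open>Ck_on\<close> concerns a point and its neighbourhood. This gives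
  smoothness of a locally finite series, which agrees with different partial sums on different open
  sets.\<close>

lemma Ck_on_locally:
  assumes "\<And>x. x \<in> S \<Longrightarrow> \<exists>U. open U \<and> x \<in> U \<and> Ck_on k U f"
  shows "Ck_on k S f"
  using assms
proof (induction k arbitrary: f)
  case 0
  then show ?case
    by (auto intro!: continuous_at_imp_continuous_on) (metis continuous_on_eq_continuous_at)
next
  case (Suc k)
  then show ?case by (metis Ck_on.simps(2))
qed

lemma Ck_on_const: "open S \<Longrightarrow> Ck_on k S (\<lambda>x. c)"
  by (induction k arbitrary: c)
     (auto intro!: Ck_on_SucI[where D="\<lambda>x. 0"] GDERIV_const)

lemma Ck_on_add:
  assumes "open S"
  shows "Ck_on k S f \<Longrightarrow> Ck_on k S g \<Longrightarrow> Ck_on k S (\<lambda>x. f x + g x)"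
proof (induction k arbitrary: f g)
  case (Suc k)
  show ?case
  proof (rule Ck_on_SucI[OF assms, where D="\<lambda>x. grad f x + grad g x"])
    show "Ck_on k S (\<lambda>x. inner v (grad f x + grad g x))" for v
      using Suc by (auto simp: inner_add_right Ck_on_Suc_iff[OF assms] simp del: Ck_on.simps)
  qed (use Suc.prems in \<open>auto intro!: GDERIV_add GDERIV_grad\<close>)
qed (auto intro: continuous_intros)

lemma Ck_on_mult:
  assumes "open S"
  shows "Ck_on k S f \<Longrightarrow> Ck_on k S g \<Longrightarrow> Ck_on k S (\<lambda>x. f x * g x)"
proof (induction k arbitrary: f g)
  case (Suc k)
  show ?case
  proof (rule Ck_on_SucI[OF assms, where D="\<lambda>x. f x *\<^sub>R grad g x + g x *\<^sub>R grad f x"])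
    \<comment> \<open>The gradient of a product contains \<open>f\<close> and \<open>g\<close>
      undifferentiated, so their regularity is lowered from \<open>Suc k\<close> to \<open>k\<close>
      before the induction hypothesis applies.\<close>
    show "Ck_on k S (\<lambda>x. inner v (f x *\<^sub>R grad g x + g x *\<^sub>R grad f x))" for v
      using Suc.IH Suc.prems Suc.prems[THEN Ck_on_SucD]
      by (auto simp: inner_add_right Ck_on_Suc_iff[OF assms] simp del: Ck_on.simps
          intro!: Ck_on_add[OF assms])
  qed (use Suc.prems in \<open>auto intro!: GDERIV_mult GDERIV_grad\<close>)
qed (auto intro: continuous_intros)

lemma Ck_on_sum:
  assumes "open S" "\<And>i. i \<in> I \<Longrightarrow> Ck_on k S (f i)"
  shows "Ck_on k S (\<lambda>x. \<Sum>i\<in>I. f i x)"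
  using assms(2)
  by (induction I rule: infinite_finite_induct) (auto intro: Ck_on_add Ck_on_const assms(1))

lemma GDERIV_sum:
  "(\<And>i. i \<in> I \<Longrightarrow> GDERIV (f i) x :> D i) \<Longrightarrow> GDERIV (\<lambda>x. \<Sum>i\<in>I. f i x) x :> (\<Sum>i\<in>I. D i)"
  unfolding gderiv_def inner_sum_right by (rule has_derivative_sum)

lemma Cinf_on_mult: "open S \<Longrightarrow> Cinf_on S f \<Longrightarrow> Cinf_on S g \<Longrightarrow> Cinf_on S (\<lambda>x. f x * g x)"
  unfolding Cinf_on_def using Ck_on_mult by blast

lemma Cinf_on_add: "open S \<Longrightarrow> Cinf_on S f \<Longrightarrow> Cinf_on S g \<Longrightarrow> Cinf_on S (\<lambda>x. f x + g x)"
  unfolding Cinf_on_def using Ck_on_add by blast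

lemma Cinf_on_const: "open S \<Longrightarrow> Cinf_on S (\<lambda>x. c)"
  unfolding Cinf_on_def using Ck_on_const by blast

lemma Cinf_on_diff:
  "open S \<Longrightarrow> Cinf_on S f \<Longrightarrow> Cinf_on S g \<Longrightarrow> Cinf_on S (\<lambda>x. f x - g x)"
  using Cinf_on_add[of S f "\<lambda>x. - 1 * g x"] Cinf_on_mult[of S "\<lambda>x. - 1" g] Cinf_on_const[of S "- 1"]
  by simp

lemma Cinf_on_differentiable: "Cinf_on S f \<Longrightarrow> x \<in> S \<Longrightarrow> f differentiable (at x)"
  unfolding Cinf_on_def by (metis Ck_on.simps(2))

lemma Cinf_on_continuous: "Cinf_on S f \<Longrightarrow> continuous_on S f"
  unfolding Cinf_on_def by (metis Ck_on.simps(1))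

lemma Cinf_on_inner_grad:
  assumes "open S" "Cinf_on S f"
  shows "Cinf_on S (\<lambda>x. inner v (grad f x))"
  using assms unfolding Cinf_on_def by (metis Ck_on_Suc_iff)

lemma Cinf_on_continuous_grad:
  fixes f :: "'a::euclidean_space \<Rightarrow> real"
  assumes "open S" "Cinf_on S f"
  shows "continuous_on S (grad f)"
proof -
  have "continuous_on S (\<lambda>x. \<Sum>b\<in>Basis. inner b (grad f x) *\<^sub>R b)"
    by (intro continuous_intros Cinf_on_continuous Cinf_on_inner_grad assms)
  then show ?thesis by (simp add: inner_commute[of _ "grad f _"] euclidean_representation)
qed

section \<open>A smooth bump function\<close>

text \<open>The classical flat function exp(-1/t) with its quotients by powers of \<open>t\<close>:
  up to linear combinations the family is closed under differentiation, so one induction treats all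
  orders.\<close>

definition flat_exp :: "nat \<Rightarrow> real \<Rightarrow> real" where
  "flat_exp k t = (if t > 0 then exp (- 1 / t) / t ^ k else 0)"

text \<open>With s = 1/t the limit from the right is that of s^k / exp s at infinity.\<close>

lemma flat_exp_tendsto_0: "(flat_exp k \<longlongrightarrow> 0) (at 0)"
proof (rule filterlim_split_at)
  have "((\<lambda>t. inverse t ^ k / exp (inverse t)) \<longlongrightarrow> (0::real)) (at_right 0)"
    using filterlim_compose[OF tendsto_power_div_exp_0 filterlim_inverse_at_top_right] .
  then show "(flat_exp k \<longlongrightarrow> 0) (at_right 0)"
    by (rule Lim_transform_eventually)
       (auto simp: eventually_at_filter flat_exp_def exp_minus field_simps power_inverse)
  show "(flat_exp k \<longlongrightarrow> 0) (at_left 0)"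
    by (rule tendsto_eventually) (auto simp: eventually_at_filter flat_exp_def)
qed

lemma DERIV_flat_exp:
  "DERIV (flat_exp k) t :> flat_exp (k + 2) t - real k * flat_exp (k + 1) t"
proof -
  consider "t > 0" | "t = 0" | "t < 0" by linarith
  then show ?thesis
  proof cases
    case 1
    have "DERIV (\<lambda>t. exp (- 1 / t) / t ^ k) t :> flat_exp (k + 2) t - real k * flat_exp (k + 1) t"
    proof (cases k)
      case 0
      with 1 show ?thesis
        by (auto intro!: derivative_eq_intros simp: flat_exp_def field_simps power2_eq_square)
    next
      case (Suc m)
      define p where "p = t ^ m"
      have "DERIV (\<lambda>t. exp (- 1 / t) / t ^ k) t :> (exp (- 1 / t) * (1 / t\<^sup>2) * t ^ Suc m
          - exp (- 1 / t) * (real (Suc m) * t ^ m)) / (t ^ Suc m * t ^ Suc m)"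
        unfolding Suc using 1
        by (auto intro!: derivative_eq_intros simp: power2_eq_square simp del: power_Suc)
      moreover have "p > 0" using 1 by (simp add: p_def)
      moreover have "(exp (- 1 / t) * (1 / t\<^sup>2) * t ^ Suc m
          - exp (- 1 / t) * (real (Suc m) * t ^ m)) / (t ^ Suc m * t ^ Suc m)
        = flat_exp (k + 2) t - real k * flat_exp (k + 1) t"
        using 1 \<open>p > 0\<close> by (simp add: Suc flat_exp_def p_def[symmetric] field_simps power2_eq_square)
      ultimately show ?thesis by simp
    qed
    then show ?thesis
      by (rule has_field_derivative_transform_within_open[where S="{0<..}"])
         (use 1 in \<open>auto simp: flat_exp_def\<close>)
  next
    case 2
    \<comment> \<open>At the origin the difference quotient is itself a member of the family, with
      index raised by one, so its limit is known.\<close>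
    have "((\<lambda>h. flat_exp (k + 1) h) \<longlongrightarrow> 0) (at 0)" by (rule flat_exp_tendsto_0)
    moreover have "flat_exp (k + 1) h = (flat_exp k (0 + h) - flat_exp k 0) / h" for h
      by (auto simp: flat_exp_def)
    ultimately show ?thesis
      using 2 by (simp add: DERIV_def flat_exp_def)
  next
    case 3
    have "DERIV (\<lambda>t::real. 0::real) t :> 0" by simp
    then have "DERIV (flat_exp k) t :> 0"
      by (rule has_field_derivative_transform_within_open[where S="{..<0}"])
         (use 3 in \<open>auto simp: flat_exp_def\<close>)
    then show ?thesis using 3 by (simp add: flat_exp_def)
  qed
qed

lemma Ck_on_inner: "Ck_on k UNIV (\<lambda>x. inner v x)"
proof (cases k)
  case (Suc m)
  have "GDERIV (\<lambda>x. inner v x) x :> v" for x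
    unfolding gderiv_def by (auto intro!: derivative_eq_intros simp: inner_commute)
  then show ?thesis
    unfolding Suc by (intro Ck_on_SucI[where D="\<lambda>x. v"] Ck_on_const) auto
qed (auto intro: continuous_intros)

definition bump :: "real \<Rightarrow> 'a::euclidean_space \<Rightarrow> real" where
  "bump r z = flat_exp 0 (r\<^sup>2 - (norm z)\<^sup>2)"

text \<open>The gradient of the member with index \<open>j\<close> is a combination of those with
  indices \<open>j + 1\<close> and \<open>j + 2\<close>, times a linear factor; hence
  \<open>j\<close> stays arbitrary in the induction.\<close>

lemma Ck_on_flat_exp_norm:
  "Ck_on k UNIV (\<lambda>x::'a::euclidean_space. flat_exp j (s - inner x x))"
proof (induction k arbitrary: j)
  case 0
  have "continuous_on UNIV (flat_exp j)"
    using DERIV_flat_exp by (intro continuous_at_imp_continuous_on) (blast intro: DERIV_isCont)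
  then show ?case
    by (auto intro!: continuous_intros continuous_on_compose2[where f="\<lambda>x::'a. s - inner x x"])
next
  case (Suc k)
  let ?q = "\<lambda>x::'a. s - inner x x"
  let ?E = "\<lambda>x. flat_exp (j + 2) (?q x) + (- real j) * flat_exp (j + 1) (?q x)"
  show ?case
  proof (rule Ck_on_SucI[where D="\<lambda>x. ?E x *\<^sub>R ((- 2) *\<^sub>R x)"])
    show "GDERIV (\<lambda>x. flat_exp j (?q x)) x :> ?E x *\<^sub>R ((- 2) *\<^sub>R x)" for x
    proof -
      have "GDERIV ?q x :> (- 2) *\<^sub>R x"
        unfolding gderiv_def by (auto intro!: derivative_eq_intros simp: inner_commute)
      moreover have "DERIV (flat_exp j) (?q x) :> ?E x"
        using DERIV_flat_exp[of j "?q x"] by simp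
      ultimately show ?thesis by (rule GDERIV_DERIV_compose)
    qed
    show "Ck_on k UNIV (\<lambda>x. inner v (?E x *\<^sub>R ((- 2) *\<^sub>R x)))" for v
      using Ck_on_mult[OF open_UNIV Ck_on_add[OF open_UNIV Suc.IH[of "j+2"]
            Ck_on_mult[OF open_UNIV Ck_on_const[OF open_UNIV, of _ "- real j"] Suc.IH[of "j+1"]]]
            Ck_on_inner[of k "(- 2) *\<^sub>R v"]]
      by (simp add: inner_commute algebra_simps)
  qed auto
qed

lemma Cinf_on_bump: "Cinf_on UNIV (bump r)"
  unfolding Cinf_on_def bump_def power2_norm_eq_inner using Ck_on_flat_exp_norm by blast

lemma bump_nonneg: "0 \<le> bump r z"
  by (simp add: bump_def flat_exp_def)

lemma bump_eq_0_iff: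
  assumes "r > 0"
  shows "bump r z = 0 \<longleftrightarrow> r \<le> norm z"
proof -
  have "r\<^sup>2 \<le> (norm z)\<^sup>2 \<longleftrightarrow> r \<le> norm z"
    using abs_le_square_iff[of r "norm z"] assms by simp
  then show ?thesis by (auto simp: bump_def flat_exp_def not_less)
qed

section \<open>Mollification\<close>

text \<open>The kernel is recentred at \<open>x\<close>; for an even kernel such as
  \<open>bump\<close> this is ordinary convolution.\<close>

definition conv :: "('a::euclidean_space \<Rightarrow> real) \<Rightarrow> ('a \<Rightarrow> real) \<Rightarrow> 'a \<Rightarrow> real" where
  "conv \<psi> G x = (\<integral>y. \<psi> (y - x) * G y \<partial>lborel)"

lemma integrable_lborel_compact_support:
  fixes f :: "'a::euclidean_space \<Rightarrow> real"
  assumes "compact S" "continuous_on S f" "\<And>x. x \<notin> S \<Longrightarrow> f x = 0"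
  shows "integrable lborel f"
proof -
  have "(\<lambda>x. indicator S x *\<^sub>R f x) = f" using assms(3) by (intro ext) (auto simp: indicator_def)
  then show ?thesis using borel_integrable_compact[OF assms(1,2)] by simp
qed

text \<open>The compact support of the kernel turns the integral over the space into a gauge
  integral over a box, the setting of \<open>leibniz_rule\<close>.\<close>

lemma conv_eq_integral_cbox:
  fixes \<psi> G :: "'a::euclidean_space \<Rightarrow> real"
  assumes "continuous_on UNIV \<psi>" "\<And>z. R \<le> norm z \<Longrightarrow> \<psi> z = 0" "continuous_on UNIV G"
    "cball x R \<subseteq> cbox a b"
  shows "conv \<psi> G x = integral (cbox a b) (\<lambda>y. \<psi> (y - x) * G y)"
proof -
  have cont: "continuous_on S (\<lambda>y. \<psi> (y - x) * G y)" for S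
    using assms(1,3)
    by (intro continuous_on_mult continuous_on_compose2[OF assms(1)] continuous_intros
        continuous_on_subset[OF assms(3)]) auto
  have zero: "\<psi> (y - x) * G y = 0" if "y \<notin> cbox a b" for y
    using that assms(2)[of "y - x"] assms(4) by (auto simp: dist_norm norm_minus_commute subset_eq)
  have "integrable lborel (\<lambda>y. \<psi> (y - x) * G y)"
    by (rule integrable_lborel_compact_support[OF compact_cbox cont zero])
  then have "conv \<psi> G x = integral UNIV (\<lambda>y. \<psi> (y - x) * G y)"
    unfolding conv_def by (simp add: integral_lborel)
  also have "\<dots> = integral (cbox a b) (\<lambda>y. \<psi> (y - x) * G y)"
    by (rule integral_spike_set)
       (auto intro!: empty_imp_negligible dest: zero)
  finally show ?thesis .
qed

text \<open>Differentiation under the integral sign. Only the kernel is differentiated, so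
  continuity of \<open>G\<close> is enough.\<close>

lemma has_derivative_conv:
  fixes \<psi> G :: "'a::euclidean_space \<Rightarrow> real"
  assumes \<psi>: "Cinf_on UNIV \<psi>" and R: "\<And>z. R \<le> norm z \<Longrightarrow> \<psi> z = 0"
    and R': "\<And>z. R \<le> norm z \<Longrightarrow> grad \<psi> z = 0"
    and G: "continuous_on UNIV G"
  shows "(conv \<psi> G has_derivative (\<lambda>v. conv (\<lambda>z. - inner v (grad \<psi> z)) G x)) (at x)"
proof -
  \<comment> \<open>The extra unit makes one box contain the supports of all kernels centred in
    \<open>ball x 1\<close>.\<close>
  obtain a where a: "cball x (R + 1) \<subseteq> cbox (-a) a"
    using bounded_subset_cbox_symmetric[OF bounded_cball] by blast
  have sub: "cball u R \<subseteq> cbox (-a) a" if "u \<in> ball x 1" for u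
  proof -
    have "cball u R \<subseteq> cball x (R + 1)"
      using that by (auto simp: subset_eq) (smt (verit) dist_triangle dist_commute)
    then show ?thesis using a by blast
  qed
  \<comment> \<open>The derivative of the integrand in \<open>u\<close> as a bounded linear
    functional; the minus sign comes from \<open>\<psi> (t - u)\<close>.\<close>
  define F where "F u t = blinfun_inner_left ((- G t) *\<^sub>R grad \<psi> (t - u))" for u t
  have c\<psi>: "continuous_on UNIV \<psi>" and cg: "continuous_on UNIV (grad \<psi>)"
    using \<psi> by (auto intro: Cinf_on_continuous Cinf_on_continuous_grad)
  have contF: "continuous_on (ball x 1 \<times> cbox (-a) a) (\<lambda>(u, t). F u t)"
    unfolding F_def case_prod_beta
    by (intro bounded_linear.continuous_on[OF bounded_linear_blinfun_inner_left] continuous_intros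
        continuous_on_compose2[OF cg] continuous_on_compose2[OF G]) auto
  have "((\<lambda>u. integral (cbox (-a) a) (\<lambda>t. \<psi> (t - u) * G t)) has_derivative
      integral (cbox (-a) a) (F x)) (at x within ball x 1)"
  proof (rule leibniz_rule[OF _ _ contF])
    fix u t
    have "(\<psi> has_derivative (\<lambda>h. inner h (grad \<psi> (t - u)))) (at (t - u))"
      using GDERIV_grad[OF Cinf_on_differentiable[OF \<psi> UNIV_I]] unfolding gderiv_def .
    then have "((\<lambda>u. \<psi> (t - u)) has_derivative (\<lambda>h. inner (- h) (grad \<psi> (t - u)))) (at u within ball x 1)"
      by (rule has_derivative_compose[rotated]) (auto intro!: derivative_eq_intros)
    then show "((\<lambda>u. \<psi> (t - u) * G t) has_derivative blinfun_apply (F u t)) (at u within ball x 1)"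
      by (rule has_derivative_eq_rhs[OF has_derivative_mult_left]) (auto simp: F_def)
  next
    fix u show "(\<lambda>t. \<psi> (t - u) * G t) integrable_on cbox (-a) a"
      by (intro integrable_continuous continuous_on_mult continuous_on_compose2[OF c\<psi>]
          continuous_intros continuous_on_subset[OF G]) auto
  qed auto
  then have "((\<lambda>u. integral (cbox (-a) a) (\<lambda>t. \<psi> (t - u) * G t)) has_derivative
      integral (cbox (-a) a) (F x)) (at x)"
    by (simp add: at_within_open[of x "ball x 1"])
  then have D: "(conv \<psi> G has_derivative integral (cbox (-a) a) (F x)) (at x)"
    by (rule has_derivative_transform_within_open[of _ _ x UNIV "ball x 1"])
       (auto intro!: conv_eq_integral_cbox[OF c\<psi> R G sub, symmetric])
  have "blinfun_apply (integral (cbox (-a) a) (F x)) v = conv (\<lambda>z. - inner v (grad \<psi> z)) G x" for v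
  proof -
    have "continuous_on (cbox (-a) a) (F x)"
      unfolding F_def
      by (intro bounded_linear.continuous_on[OF bounded_linear_blinfun_inner_left] continuous_intros
        continuous_on_compose2[OF cg] continuous_on_subset[OF G]) auto
    then have "blinfun_apply (integral (cbox (-a) a) (F x)) v
        = integral (cbox (-a) a) (\<lambda>t. blinfun_apply (F x t) v)"
      by (intro blinfun_apply_integral integrable_continuous)
    also have "\<dots> = integral (cbox (-a) a) (\<lambda>t. (- inner v (grad \<psi> (t - x))) * G t)"
      by (intro integral_cong) (simp add: F_def)
    also have "\<dots> = conv (\<lambda>z. - inner v (grad \<psi> z)) G x"
      by (rule conv_eq_integral_cbox[OF _ _ G sub, symmetric])
         (auto simp: R' intro!: continuous_intros cg)
    finally show ?thesis .
  qed
  then have "blinfun_apply (integral (cbox (-a) a) (F x)) = (\<lambda>v. conv (\<lambda>z. - inner v (grad \<psi> z)) G x)"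
    by (rule ext)
  then show ?thesis using D by simp
qed

text \<open>A directional derivative is again a \<open>conv\<close>, whose kernel is smooth and
  vanishes outside the same ball; the induction therefore runs over all such kernels.\<close>

lemma Ck_on_conv:
  fixes \<psi> G :: "'a::euclidean_space \<Rightarrow> real"
  assumes "Cinf_on UNIV \<psi>" and "\<And>z. R < norm z \<Longrightarrow> \<psi> z = 0"
    and G: "continuous_on UNIV G"
  shows "Ck_on k UNIV (conv \<psi> G)"
  using assms(1,2)
proof (induction k arbitrary: \<psi>)
  \<comment> \<open>The strict inequality cuts out an open set, so vanishing of the kernel passes to
    its gradient with the same \<open>R\<close>.\<close>
  have grad0: "grad \<psi> z = 0" if "\<And>z. R < norm z \<Longrightarrow> \<psi> z = 0" "R < norm z" for \<psi> :: "'a \<Rightarrow> real" and z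
  proof -
    have "open {z::'a. R < norm z}" by (intro open_Collect_less continuous_intros)
    then have "GDERIV \<psi> z :> 0"
      by (intro GDERIV_transform_open[OF GDERIV_const[of 0]]) (use that in auto)
    then show ?thesis by (rule grad_eq)
  qed
  have D: "(conv \<psi> G has_derivative (\<lambda>v. conv (\<lambda>z. - inner v (grad \<psi> z)) G x)) (at x)"
    if "Cinf_on UNIV \<psi>" "\<And>z. R < norm z \<Longrightarrow> \<psi> z = 0" for \<psi> x
    by (rule has_derivative_conv[where R="R+1"]) (use that grad0 G in auto)
  {
    case 0
    then show ?case
      by (auto intro!: continuous_at_imp_continuous_on has_derivative_continuous[OF D])
  next
    case (Suc k)
    have d: "GDERIV (conv \<psi> G) x :> grad (conv \<psi> G) x" for x
      by (intro GDERIV_grad) (use D[OF Suc.prems] in \<open>auto simp: differentiable_def\<close>)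
    have eq: "(\<lambda>v. inner v (grad (conv \<psi> G) x)) = (\<lambda>v. conv (\<lambda>z. - inner v (grad \<psi> z)) G x)" for x
      using d[unfolded gderiv_def] D[OF Suc.prems] by (rule has_derivative_unique)
    have "Ck_on k UNIV (conv (\<lambda>z. - inner v (grad \<psi> z)) G)" for v
    proof (rule Suc.IH)
      show "Cinf_on UNIV (\<lambda>z. - inner v (grad \<psi> z))"
        using Cinf_on_diff[OF open_UNIV Cinf_on_const[OF open_UNIV, of 0]
            Cinf_on_inner_grad[OF open_UNIV Suc.prems(1)]] by simp
    qed (simp add: grad0[OF Suc.prems(2)])
    then show ?case
      using fun_cong[OF eq] by (intro Ck_on_SucI[OF _ d]) auto
  }
qed

definition mollify :: "real \<Rightarrow> ('a::euclidean_space \<Rightarrow> real) \<Rightarrow> 'a \<Rightarrow> real" where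
  "mollify e G = conv (\<lambda>z. bump e z / (\<integral>y. bump e (y::'a) \<partial>lborel)) G"

lemma continuous_bump: "continuous_on S (bump e)"
  using Cinf_on_continuous[OF Cinf_on_bump] continuous_on_subset by blast

lemma bump_eq_0: "0 < e \<Longrightarrow> e \<le> norm z \<Longrightarrow> bump e z = 0"
  by (simp add: bump_eq_0_iff)

lemma integrable_bump: "0 < e \<Longrightarrow> integrable lborel (bump e :: 'a::euclidean_space \<Rightarrow> real)"
  by (rule integrable_lborel_compact_support[of "cball 0 e"]) 
     (auto intro: continuous_bump simp: bump_eq_0)

lemma integral_bump_pos:
  assumes "0 < e"
  shows "0 < (\<integral>y. bump e (y::'a::euclidean_space) \<partial>lborel)"
proof -
  have "0 \<le> (\<integral>y. bump e (y::'a) \<partial>lborel)" by (simp add: bump_nonneg)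
  moreover have "(\<integral>y. bump e (y::'a) \<partial>lborel) \<noteq> 0"
  proof
    assume "(\<integral>y. bump e (y::'a) \<partial>lborel) = 0"
    then have "AE y in lborel. bump e (y::'a) = 0"
      using integral_nonneg_eq_0_iff_AE[OF integrable_bump[OF assms]] by (auto simp: bump_nonneg)
    then have "AE y in lborel. (y::'a) \<notin> ball 0 e"
      by (rule AE_mp) (auto simp: bump_eq_0_iff[OF assms])
    then have "ball (0::'a) e \<in> null_sets lborel"
      by (simp add: AE_iff_null_sets)
    then have "negligible (ball (0::'a) e)"
      by (simp add: negligible_iff_null_sets null_sets_completionI)
    then show False using assms open_not_negligible[of "ball (0::'a) e"] by simp
  qed
  ultimately show ?thesis by simp
qed

lemma Cinf_on_mollify:
  fixes G :: "'a::euclidean_space \<Rightarrow> real"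
  assumes "0 < e" "continuous_on UNIV G"
  shows "Cinf_on UNIV (mollify e G)"
  unfolding mollify_def Cinf_on_def
proof
  fix k
  have "Cinf_on UNIV (\<lambda>z::'a. bump e z * (1 / (\<integral>y. bump e (y::'a) \<partial>lborel)))"
    by (intro Cinf_on_mult Cinf_on_bump Cinf_on_const open_UNIV)
  then show "Ck_on k UNIV (conv (\<lambda>z. bump e z / (\<integral>y. bump e (y::'a) \<partial>lborel)) G)"
    by (intro Ck_on_conv[where R=e]) (use assms in \<open>auto simp: bump_eq_0\<close>)
qed

text \<open>By translation invariance this is a weighted average of translates, so values at
  different points can be compared under one integral.\<close>

lemma mollify_eq:
  fixes F :: "'a::euclidean_space \<Rightarrow> real"
  assumes "continuous_on UNIV F"
  shows "mollify e F u = (\<integral>z. bump e z / (\<integral>y. bump e (y::'a) \<partial>lborel) * F (u + z) \<partial>lborel)"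
proof -
  let ?I = "\<integral>y. bump e (y::'a) \<partial>lborel"
  have [measurable]: "F \<in> borel_measurable borel" "bump e \<in> borel_measurable (borel :: 'a measure)"
    using assms continuous_bump by (auto intro: borel_measurable_continuous_onI)
  have "mollify e F u = (\<integral>z. bump e (z - u) / ?I * F z \<partial>(distr lborel borel ((+) u)))"
    unfolding lborel_distr_plus mollify_def conv_def ..
  also have "\<dots> = (\<integral>z. bump e z / ?I * F (u + z) \<partial>lborel)"
    by (subst integral_distr) auto
  finally show ?thesis .
qed

text \<open>Functions and points are kept independent so that one estimate serves twice: a constant
  \<open>H\<close> controls the distance to a value, and \<open>G = H\<close> at two points
  transfers a Lipschitz bound.\<close>

lemma mollify_bounds:
  fixes G H :: "'a::euclidean_space \<Rightarrow> real"
  assumes e: "0 < e" and G: "continuous_on UNIV G" and H: "continuous_on UNIV H"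
    and B: "\<And>z. norm z < e \<Longrightarrow> \<bar>G (x + z) - H (y + z)\<bar> \<le> B"
  shows "\<bar>mollify e G x - mollify e H y\<bar> \<le> B"
proof -
  define I where "I = (\<integral>y. bump e (y::'a) \<partial>lborel)"
  have I: "I > 0" unfolding I_def by (rule integral_bump_pos[OF e])
  note shift = mollify_eq[where 'a='a and e=e, folded I_def]
  have int: "integrable lborel (\<lambda>z. bump e z / I * F (u + z))" if "continuous_on UNIV F" for F and u :: 'a
    by (rule integrable_lborel_compact_support[of "cball 0 e"])
       (auto simp: bump_eq_0 e intro!: continuous_intros continuous_bump continuous_on_compose2[OF that] simp: I[THEN less_imp_neq, symmetric])
  have "\<bar>mollify e G x - mollify e H y\<bar> = \<bar>\<integral>z. bump e z / I * (G (x + z) - H (y + z)) \<partial>lborel\<bar>"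
    unfolding shift[OF G] shift[OF H]
    by (subst Bochner_Integration.integral_diff[OF int[OF G] int[OF H], symmetric])
       (simp add: algebra_simps)
  also have "\<dots> \<le> (\<integral>z. bump e (z::'a) / I * B \<partial>lborel)"
  proof (rule Bochner_Integration.integral_abs_bound_integral)
    show "integrable lborel (\<lambda>z. bump e z / I * (G (x + z) - H (y + z)))"
      using Bochner_Integration.integrable_diff[OF int[OF G, of x] int[OF H, of y]]
      by (simp add: algebra_simps)
    show "integrable lborel (\<lambda>z::'a. bump e z / I * B)"
      using integrable_mult_left[OF integrable_bump[OF e], of "B / I"] by simp
    show "\<bar>bump e z / I * (G (x + z) - H (y + z))\<bar> \<le> bump e z / I * B" for z
    proof (cases "norm z < e")
      case True
      then show ?thesis
        using mult_left_mono[OF B[OF True], of "bump e z / I"] I bump_nonneg[of e z]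
        by (simp add: abs_mult)
    qed (simp add: bump_eq_0[OF e])
  qed
  also have "\<dots> = B" using I by (simp add: I_def)
  finally show ?thesis .
qed

lemma mollify_const:
  fixes x :: "'a::euclidean_space"
  assumes "0 < e"
  shows "mollify e (\<lambda>_. c) x = c"
  using integral_bump_pos[OF assms, where 'a='a] by (simp add: mollify_eq)

lemma mollify_dist_le:
  fixes G :: "'a::euclidean_space \<Rightarrow> real"
  assumes "0 < e" "continuous_on UNIV G" "\<And>y. y \<in> ball x e \<Longrightarrow> \<bar>G y - c\<bar> \<le> B"
  shows "\<bar>mollify e G x - c\<bar> \<le> B"
  using mollify_bounds[OF assms(1,2), of "\<lambda>_. c" x x B] assms(3)
  by (simp add: mollify_const[OF assms(1)] dist_norm)

section \<open>The asymptotic Lipschitz constant\<close>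

lemma lip_a_le_Lip_const:
  assumes "0 < r"
  shows "lip_a f x \<le> Lip_const f (ball x r)"
proof (rule tendsto_upperbound[OF tendsto_lip_a])
  show "\<forall>\<^sub>F s in at_right 0. Lip_const f (ball x s) \<le> Lip_const f (ball x r)"
    using assms eventually_at_right_real[OF assms]
    by (auto elim!: eventually_mono intro!: Lip_const_mono)
qed simp

text \<open>The function is lower semicontinuous: a pair witnessing a quotient above
  \<open>a\<close> stays in the ball when the centre moves a little.\<close>

lemma borel_measurable_Lip_const_ball [measurable]:
  "(\<lambda>x::'a::metric_space. Lip_const f (ball x r)) \<in> borel_measurable borel"
proof (rule borel_measurableI_greater)
  fix a
  have "open {x. a < Lip_const f (ball x r)}"
    unfolding open_dist
  proof safe
    fix x assume "a < Lip_const f (ball x r)"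
    then obtain y z where yz: "y \<in> ball x r" "z \<in> ball x r" "z \<noteq> y"
        "a < ennreal (\<bar>f y - f z\<bar> / dist y z)"
      unfolding Lip_const_def less_SUP_iff by blast
    show "\<exists>e>0. \<forall>x'. dist x' x < e \<longrightarrow> x' \<in> {x. a < Lip_const f (ball x r)}"
    proof (intro exI[of _ "min (r - dist x y) (r - dist x z)"] conjI allI impI)
      fix x' assume "dist x' x < min (r - dist x y) (r - dist x z)"
      then have "y \<in> ball x' r" "z \<in> ball x' r"
        using dist_triangle[of x' y x] dist_triangle[of x' z x] by auto
      then show "x' \<in> {x. a < Lip_const f (ball x r)}"
        unfolding Lip_const_def mem_Collect_eq less_SUP_iff using yz by blast
    qed (use yz in auto)
  qed
  then show "{x \<in> space borel. a < Lip_const f (ball x r)} \<in> sets borel" by simp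
qed

text \<open>A countable sequence of radii gives the measurability of \<open>lip_a\<close> and,
  later, the passage to the limit under the integral.\<close>

lemma Lip_const_LIMSEQ_lip_a:
  "(\<lambda>n. Lip_const f (ball x (inverse (real (Suc n))))) \<longlonglongrightarrow> lip_a f x"
proof (rule filterlim_compose[OF tendsto_lip_a])
  show "filterlim (\<lambda>n. inverse (real (Suc n))) (at_right 0) sequentially"
    using LIMSEQ_inverse_real_of_nat by (auto simp: filterlim_at)
qed

lemma borel_measurable_lip_a [measurable]:
  "lip_a (f :: 'a::metric_space \<Rightarrow> real) \<in> borel_measurable borel"
  by (rule borel_measurable_LIMSEQ_order[OF Lip_const_LIMSEQ_lip_a]) measurable

text \<open>By continuity the gradient is bounded by \<open>norm (grad f x) + e\<close> on a small
  ball, and convexity of the ball turns this into a Lipschitz bound.\<close>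

lemma Cinf_on_lipschitz_near:
  fixes f :: "'a::euclidean_space \<Rightarrow> real"
  assumes S: "open S" and f: "Cinf_on S f" and x: "x \<in> S" and "0 < e"
  obtains r where "0 < r" "ball x r \<subseteq> S" "(norm (grad f x) + e)-lipschitz_on (ball x r) f"
proof -
  have "isCont (grad f) x"
    using Cinf_on_continuous_grad[OF S f] S x continuous_on_eq_continuous_at by blast
  then obtain d where d: "d > 0" "\<And>y. dist y x < d \<Longrightarrow> dist (grad f y) (grad f x) < e"
    unfolding continuous_at_eps_delta using \<open>0 < e\<close> by blast
  obtain d' where d': "d' > 0" "ball x d' \<subseteq> S" using S x openE by blast
  let ?r = "min d d'"
  have b: "ball x ?r \<subseteq> S" using d' by auto
  have "(norm (grad f x) + e)-lipschitz_on (ball x ?r) f"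
  proof (rule bounded_derivative_imp_lipschitz)
    fix y assume y: "y \<in> ball x ?r"
    then have "GDERIV f y :> grad f y"
      using b by (intro GDERIV_grad Cinf_on_differentiable[OF f]) auto
    then show "(f has_derivative (\<lambda>h. inner h (grad f y))) (at y within ball x ?r)"
      unfolding gderiv_def by (rule has_derivative_at_withinI)
    have "norm (grad f y) \<le> norm (grad f x) + e"
      using d(2)[of y] y norm_triangle_sub[of "grad f y" "grad f x"] by (auto simp: dist_norm dist_commute norm_minus_commute)
    then have "norm (inner h (grad f y)) \<le> (norm (grad f x) + e) * norm h" for h
      by (smt (verit) Cauchy_Schwarz_ineq2 mult.commute mult_right_mono norm_ge_zero real_norm_def)
    then show "onorm (\<lambda>h. inner h (grad f y)) \<le> norm (grad f x) + e"
      by (intro onorm_le)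
  qed (use \<open>0 < e\<close> in auto)
  then show ?thesis using that[of ?r] b d d' by auto
qed

lemma Cinf_on_imp_loc_lipschitz_on:
  assumes "open S" "Cinf_on S f"
  shows "loc_lipschitz_on S f"
  unfolding loc_lipschitz_on_def
  using Cinf_on_lipschitz_near[OF assms, of _ 1] lipschitz_on_subset
  by (metis inf_le1 zero_less_one)

lemma lip_a_le_norm_grad:
  assumes "open S" "Cinf_on S f" "x \<in> S"
  shows "lip_a f x \<le> ennreal (norm (grad f x))"
proof (rule ennreal_le_epsilon)
  fix e :: real assume "0 < e"
  then obtain r where "0 < r" "(norm (grad f x) + e)-lipschitz_on (ball x r) f"
    using Cinf_on_lipschitz_near[OF assms] by blast
  then show "lip_a f x \<le> ennreal (norm (grad f x)) + ennreal e"
    using lip_a_le_Lip_const[of r f x] \<open>0 < e\<close> by (auto simp: lipschitz_on_iff_Lip_const)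
qed

text \<open>The derivative along the gradient equals its squared norm, while the difference
  quotients in that direction are at most \<open>L\<close> times its norm.\<close>

lemma norm_grad_le:
  fixes f :: "'a::euclidean_space \<Rightarrow> real"
  assumes f: "f differentiable (at x)" and r: "0 < r"
    and L: "\<And>y. y \<in> ball x r \<Longrightarrow> \<bar>f y - f x\<bar> \<le> L * dist y x"
  shows "norm (grad f x) \<le> L"
proof (cases "grad f x = 0")
  \<comment> \<open>The claim is now \<open>0 \<le> L\<close>, read off from the hypothesis at one
    point distinct from \<open>x\<close>.\<close>
  case True
  obtain b :: 'a where b: "b \<in> Basis" using nonempty_Basis by blast
  have "x + (r/2) *\<^sub>R b \<in> ball x r" using r b by (simp add: dist_norm)
  from order.trans[OF abs_ge_zero L[OF this]] have "0 \<le> L * (r/2)" using r b by (simp add: dist_norm)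
  then show ?thesis using True r by (simp add: zero_le_mult_iff)
next
  case False
  define v where "v = grad f x"
  have v: "v \<noteq> 0" using False v_def by simp
  have "((\<lambda>t. f (x + t *\<^sub>R v)) has_derivative (\<lambda>t. inner (t *\<^sub>R v) v)) (at 0)"
  proof (rule has_derivative_compose[where g=f])
    show "((\<lambda>t. x + t *\<^sub>R v) has_derivative (\<lambda>t. t *\<^sub>R v)) (at 0)"
      by (auto intro!: derivative_eq_intros)
    show "(f has_derivative (\<lambda>h. inner h v)) (at (x + 0 *\<^sub>R v))"
      using GDERIV_grad[OF f] by (simp add: gderiv_def v_def)
  qed
  then have "DERIV (\<lambda>t. f (x + t *\<^sub>R v)) 0 :> inner v v"
    unfolding has_field_derivative_def by (simp add: mult_commute_abs)
  then have lim: "((\<lambda>h. (f (x + h *\<^sub>R v) - f x) / h) \<longlongrightarrow> inner v v) (at 0)"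
    by (simp add: DERIV_def)
  have ev: "\<forall>\<^sub>F h in at 0. (f (x + h *\<^sub>R v) - f x) / h \<le> L * norm v"
    unfolding eventually_at
  proof (intro exI[of _ "r / norm v"] conjI ballI impI)
    fix h :: real assume h: "h \<noteq> 0 \<and> dist h 0 < r / norm v"
    then have "x + h *\<^sub>R v \<in> ball x r" using v by (simp add: dist_norm pos_less_divide_eq)
    from L[OF this] have "\<bar>f (x + h *\<^sub>R v) - f x\<bar> \<le> (L * norm v) * \<bar>h\<bar>"
      by (simp add: dist_norm mult_ac)
    then have "\<bar>(f (x + h *\<^sub>R v) - f x) / h\<bar> \<le> L * norm v"
      using h by (simp add: abs_divide pos_divide_le_eq)
    then show "(f (x + h *\<^sub>R v) - f x) / h \<le> L * norm v" by linarith
  qed (use r v in auto)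
  have "inner v v \<le> L * norm v"
    by (rule tendsto_upperbound[OF lim ev]) simp
  then have "norm v * norm v \<le> L * norm v"
    by (metis power2_eq_square power2_norm_eq_inner)
  then show ?thesis using v v_def by simp
qed

text \<open>Averaging translates preserves a Lipschitz bound. The radius is \<open>2 * e\<close>
  because a point within \<open>e\<close> of \<open>x\<close> is shifted by less than
  \<open>e\<close> once more.\<close>

lemma norm_grad_mollify_le:
  fixes G :: "'a::euclidean_space \<Rightarrow> real"
  assumes e: "0 < e" and G: "continuous_on UNIV G" and L: "L-lipschitz_on (ball x (2 * e)) G"
  shows "norm (grad (mollify e G) x) \<le> L"
proof (rule norm_grad_le[OF _ e])
  show "mollify e G differentiable (at x)"
    using Cinf_on_differentiable[OF Cinf_on_mollify[OF e G]] by simp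
  fix y assume y: "y \<in> ball x e"
  show "\<bar>mollify e G y - mollify e G x\<bar> \<le> L * dist y x"
  proof (rule mollify_bounds[OF e G G])
    fix z :: 'a assume z: "norm z < e"
    have "y + z \<in> ball x (2 * e)"
      using z y norm_triangle_ineq4[of "x - y" z] by (simp add: dist_norm algebra_simps)
    moreover have "x + z \<in> ball x (2 * e)" using z e by (simp add: dist_norm)
    ultimately have "dist (G (y + z)) (G (x + z)) \<le> L * dist (y + z) (x + z)"
      using L lipschitz_onD by blast
    then show "\<bar>G (y + z) - G (x + z)\<bar> \<le> L * dist y x" by (simp add: dist_norm)
  qed
qed

text \<open>A Lebesgue number argument: a finite subcover yields one radius and one constant for all
  of \<open>K\<close>.\<close>

lemma loc_lipschitz_on_compact:
  fixes g :: "'a::metric_space \<Rightarrow> real"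
  assumes S: "open S" and g: "loc_lipschitz_on S g" and K: "compact K" "K \<subseteq> S"
  obtains r L where "0 < r" "0 \<le> L" "\<And>x. x \<in> K \<Longrightarrow> ball x r \<subseteq> S \<and> L-lipschitz_on (ball x r) g"
proof -
  \<comment> \<open>The doubled radius leaves room for a ball of radius at most \<open>r\<close>
    around any point of \<open>ball x r\<close>.\<close>
  have "\<exists>r L. 0 < r \<and> ball x (2 * r) \<subseteq> S \<and> L-lipschitz_on (ball x (2 * r)) g" if "x \<in> K" for x
  proof -
    have "x \<in> S" using that K(2) by blast
    then obtain s L where s: "s > 0" "L-lipschitz_on (ball x s \<inter> S) g"
      using g unfolding loc_lipschitz_on_def by metis
    obtain t where t: "t > 0" "ball x t \<subseteq> S" using openE[OF S \<open>x \<in> S\<close>] by metis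
    show ?thesis
      using s t by (intro exI[of _ "min s t / 2"] exI[of _ L])
        (auto intro!: lipschitz_on_subset[OF s(2)])
  qed
  then obtain r L where r: "\<And>x. x \<in> K \<Longrightarrow> 0 < r x" "\<And>x. x \<in> K \<Longrightarrow> ball x (2 * r x) \<subseteq> S"
      "\<And>x. x \<in> K \<Longrightarrow> (L x)-lipschitz_on (ball x (2 * r x)) g" by metis
  have "K \<subseteq> (\<Union>x\<in>K. ball x (r x))" using r(1) by auto
  then obtain D where D: "D \<subseteq> K" "finite D" "K \<subseteq> (\<Union>x\<in>D. ball x (r x))"
    using compactE_image[OF K(1), of K "\<lambda>x. ball x (r x)"] by auto
  \<comment> \<open>The inserted \<open>1\<close> and, on the next line, \<open>0\<close> cover an
    empty \<open>D\<close>; the \<open>0\<close> also makes \<open>M\<close> nonnegative.\<close>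
  define \<rho> where "\<rho> = Min (insert 1 (r ` D))"
  define M where "M = Max (insert 0 (L ` D))"
  have M: "0 \<le> M" "\<And>x. x \<in> D \<Longrightarrow> L x \<le> M" using D(2) by (auto simp: M_def)
  have \<rho>: "0 < \<rho>" "\<And>x. x \<in> D \<Longrightarrow> \<rho> \<le> r x" using D r(1) by (auto simp: \<rho>_def)
  show ?thesis
  proof (rule that[OF \<rho>(1) M(1)])
    fix y assume "y \<in> K"
    then obtain x where x: "x \<in> D" "dist x y < r x" using D(3) by auto
    have "ball y \<rho> \<subseteq> ball x (2 * r x)"
    proof
      fix z assume "z \<in> ball y \<rho>"
      then show "z \<in> ball x (2 * r x)"
        using x \<rho>(2)[OF x(1)] dist_triangle[of x z y] by simp
    qed
    moreover have "M-lipschitz_on (ball x (2 * r x)) g"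
      using r(3) M(2) x D(1) lipschitz_on_le by blast
    ultimately show "ball y \<rho> \<subseteq> S \<and> M-lipschitz_on (ball y \<rho>) g"
      using r(2) x D(1) lipschitz_on_subset by blast
  qed
qed

section \<open>Smooth approximation of locally Lipschitz functions\<close>

text \<open>The cutoff is a mollified piecewise linear function of the distance to
  \<open>K\<close>.\<close>

lemma smooth_cutoff:
  fixes K U :: "'a::euclidean_space set"
  assumes K: "compact K" and U: "open U" and "K \<subseteq> U"
  obtains \<eta> where "Cinf_on UNIV \<eta>" "\<And>x. 0 \<le> \<eta> x" "\<And>x. \<eta> x \<le> 1"
    "\<And>x. x \<in> K \<Longrightarrow> \<eta> x = 1" "\<And>x. x \<notin> U \<Longrightarrow> \<eta> x = (0::real)"
\<comment> \<open>\<open>infdist\<close> to the empty set is \<open>0\<close>, which would make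
  \<open>u\<close> below equal to \<open>1\<close> everywhere.\<close>
proof (cases "K = {}")
  case True
  then show ?thesis using that[of "\<lambda>_. 0"] by (auto intro: Cinf_on_const)
next
  case False
  obtain d where d: "d > 0" "\<And>x y. x \<in> K \<Longrightarrow> y \<in> - U \<Longrightarrow> d \<le> dist x y"
    using separate_compact_closed[OF K, of "- U"] U \<open>K \<subseteq> U\<close> by blast
  \<comment> \<open>The gap is cut into three: \<open>u\<close> is \<open>1\<close> up to distance
    \<open>e\<close> from \<open>K\<close> and \<open>0\<close> from \<open>2 * e\<close> on, so
    averaging over radius \<open>e\<close> keeps \<open>1\<close> on \<open>K\<close> and
    \<open>0\<close> outside \<open>U\<close>.\<close>
  define e where "e = d / 3"
  have e: "e > 0" using d e_def by simp
  define u where "u y = max 0 (min 1 (2 - infdist y K / e))" for y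
  have u: "continuous_on UNIV u" unfolding u_def by (intro continuous_intros) (use e in auto)
  have one: "u y = 1" if "infdist y K \<le> e" for y
    using that e by (simp add: u_def field_simps)
  have zero: "u y = 0" if "2 * e \<le> infdist y K" for y
    using that e by (simp add: u_def field_simps)
  show ?thesis
  proof (rule that[of "mollify e u"])
    show "Cinf_on UNIV (mollify e u)" using e u by (rule Cinf_on_mollify)
    fix x
    \<comment> \<open>Centre and radius \<open>1/2\<close> encode the bounds \<open>0\<close> and
      \<open>1\<close> at once.\<close>
    have "\<bar>mollify e u x - 1/2\<bar> \<le> 1/2"
      by (rule mollify_dist_le[OF e u]) (auto simp: u_def abs_if)
    then show "0 \<le> mollify e u x" "mollify e u x \<le> 1" by (auto simp: abs_if split: if_splits)
    show "mollify e u x = 1" if "x \<in> K"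
    proof -
      have "\<bar>mollify e u x - 1\<bar> \<le> 0"
      proof (rule mollify_dist_le[OF e u])
        fix y assume "y \<in> ball x e"
        then show "\<bar>u y - 1\<bar> \<le> 0"
          using infdist_le[OF that, of y] by (simp add: one dist_commute)
      qed
      then show ?thesis by simp
    qed
    show "mollify e u x = 0" if "x \<notin> U"
    proof -
      obtain k where k: "k \<in> K" "infdist x K = dist x k"
        using infdist_attains_inf[OF compact_imp_closed[OF K] False] by metis
      have *: "3 * e \<le> infdist x K" using d(2)[OF k(1), of x] that k by (simp add: e_def dist_commute)
      have "\<bar>mollify e u x - 0\<bar> \<le> 0"
      proof (rule mollify_dist_le[OF e u])
        fix y assume "y \<in> ball x e"
        then show "\<bar>u y - 0\<bar> \<le> 0"
          using infdist_triangle[of x K y] * by (simp add: zero)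
      qed
      then show ?thesis by simp
    qed
  qed
qed

lemma grad_eq_0_outside:
  assumes "closed K" "\<And>x. x \<notin> K \<Longrightarrow> f x = 0" "x \<notin> K"
  shows "grad f x = 0"
proof (rule grad_eq)
  show "GDERIV f x :> 0"
    by (rule GDERIV_transform_open[OF GDERIV_const[of 0], of "- K"]) (use assms in auto)
qed

text \<open>Unlike \<open>grad g\<close>, which exists only almost everywhere for Lebesgue measure, the bound
  by \<open>Lip_const g\<close> on shrinking balls holds at every point, so that \<open>\<mu>\<close> may be arbitrary.\<close>

lemma mollify_approx_compact:
  fixes g :: "'a::euclidean_space \<Rightarrow> real"
  assumes S: "open S" and g: "loc_lipschitz_on S g" and K: "compact K" "K \<subseteq> S"
  obtains e0 L where "0 < e0" "0 \<le> L"
    "\<And>x e. x \<in> K \<Longrightarrow> e \<le> e0 \<Longrightarrow> Lip_const g (ball x e) \<le> ennreal L"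
    "\<And>e. 0 < e \<Longrightarrow> e \<le> e0 \<Longrightarrow> \<exists>\<gamma>. Cinf_on UNIV \<gamma> \<and>
      (\<forall>x\<in>K. \<bar>\<gamma> x - g x\<bar> \<le> L * e \<and> ennreal (norm (grad \<gamma> x)) \<le> Lip_const g (ball x (2 * e)))"
proof -
  obtain r L where r: "0 < r" "0 \<le> L"
      and rL: "\<And>x. x \<in> K \<Longrightarrow> ball x r \<subseteq> S \<and> L-lipschitz_on (ball x r) g"
    using loc_lipschitz_on_compact[OF S g K] by blast
  \<comment> \<open>The closed \<open>r / 2\<close>-neighbourhood of \<open>K\<close>, compact as a
    sum of compact sets.\<close>
  define A where "A = (\<Union>x\<in>K. \<Union>z\<in>cball 0 (r / 2). {x + z})"
  have A: "compact A" unfolding A_def by (intro compact_sums' K compact_cball)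
  have ballA: "ball x (r / 2) \<subseteq> A" if "x \<in> K" for x
  proof
    fix y assume "y \<in> ball x (r / 2)"
    then have "y - x \<in> cball 0 (r / 2)" by (simp add: dist_norm norm_minus_commute)
    moreover have "y = x + (y - x)" by simp
    ultimately show "y \<in> A" unfolding A_def using that by blast
  qed
  have "isCont g y" if "y \<in> A" for y
  proof -
    obtain x z where "x \<in> K" "norm z \<le> r / 2" "y = x + z" using \<open>y \<in> A\<close> by (auto simp: A_def)
    then have "y \<in> ball x r" using r by (simp add: dist_norm)
    then show ?thesis
      using rL[OF \<open>x \<in> K\<close>] lipschitz_on_continuous_on continuous_on_eq_continuous_at[OF open_ball]
      by metis
  qed
  then have "continuous_on A g" by (intro continuous_at_imp_continuous_on) blast
  \<comment> \<open>The facts on \<open>mollify\<close> ask for continuity on the whole space. A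
    Tietze extension of \<open>g\<close> from \<open>A\<close> provides it, and at points of
    \<open>K\<close> small-scale averages see only values on \<open>A\<close>.\<close>
  then obtain G where G: "continuous_on UNIV G" "\<And>x. x \<in> A \<Longrightarrow> G x = g x"
    using Tietze_unbounded[of A g UNIV] compact_imp_closed[OF A] by auto
  show ?thesis
  \<comment> \<open>For \<open>e \<le> r / 4\<close> the balls of radius \<open>2 * e\<close> around
    points of \<open>K\<close> lie in \<open>A\<close>.\<close>
  proof (rule that[of "r / 4" L])
    show Lip: "Lip_const g (ball x e) \<le> ennreal L" if "x \<in> K" "e \<le> r / 4" for x e
    proof -
      have "L-lipschitz_on (ball x e) g"
        using rL[OF that(1)] that(2) r(1) by (auto intro: lipschitz_on_subset)
      then show ?thesis by (simp add: lipschitz_on_iff_Lip_const)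
    qed
    show "\<exists>\<gamma>. Cinf_on UNIV \<gamma> \<and>
      (\<forall>x\<in>K. \<bar>\<gamma> x - g x\<bar> \<le> L * e \<and> ennreal (norm (grad \<gamma> x)) \<le> Lip_const g (ball x (2 * e)))"
      if e: "0 < e" "e \<le> r / 4" for e
    proof (intro exI[of _ "mollify e G"] conjI ballI)
      show "Cinf_on UNIV (mollify e G)" using e(1) G(1) by (rule Cinf_on_mollify)
      fix x assume x: "x \<in> K"
      have sub: "ball x (2 * e) \<subseteq> A" "ball x (2 * e) \<subseteq> ball x r"
        using ballA[OF x] e r(1) by (auto simp: subset_eq)
      show "\<bar>mollify e G x - g x\<bar> \<le> L * e"
      proof (rule mollify_dist_le[OF e(1) G(1)])
        fix y assume y: "y \<in> ball x e"
        then have "dist (g y) (g x) \<le> L * dist y x"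
          using rL[OF x] e r(1) by (intro lipschitz_onD[of L "ball x r"]) auto
        also have "\<dots> \<le> L * e" using y r(2) by (intro mult_left_mono) (auto simp: dist_commute)
        finally show "\<bar>G y - g x\<bar> \<le> L * e"
          using sub(1) y e(1) by (simp add: G(2) subset_eq dist_real_def)
      qed
      \<comment> \<open>The local constant is finite; using it instead of the uniform
        \<open>L\<close> lets the gradient bound decrease to \<open>lip_a g x\<close>.\<close>
      define M where "M = enn2real (Lip_const g (ball x (2 * e)))"
      have "L-lipschitz_on (ball x (2 * e)) g"
        using rL[OF x] sub(2) lipschitz_on_subset by blast
      then have M: "Lip_const g (ball x (2 * e)) = ennreal M"
        unfolding M_def lipschitz_on_iff_Lip_const
        by (metis ennreal_enn2real ennreal_less_top le_less_trans)
      have "M-lipschitz_on (ball x (2 * e)) g"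
        unfolding lipschitz_on_iff_Lip_const M by (simp add: M_def)
      then have "M-lipschitz_on (ball x (2 * e)) G"
        by (rule lipschitz_on_transform) (use sub(1) G(2) in auto)
      then have "norm (grad (mollify e G) x) \<le> M"
        using e(1) G(1) by (intro norm_grad_mollify_le)
      then show "ennreal (norm (grad (mollify e G) x)) \<le> Lip_const g (ball x (2 * e))"
        unfolding M by (rule ennreal_leI)
    qed
  qed (use r in auto)
qed

text \<open>Dominated convergence carries the bound by \<open>Lip_const g\<close> on shrinking balls
  to \<open>lip_a g\<close>, since the weight lives on \<open>K\<close>, of finite measure. The
  first two estimates come from uniform closeness on \<open>K\<close>.\<close>

lemma smooth_approx_weighted:
  fixes g \<phi> :: "'a::euclidean_space \<Rightarrow> real"
  assumes sets: "sets \<mu> = sets borel" and fin: "emeasure \<mu> K < \<infinity>"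
    and S: "open S" and g: "loc_lipschitz_on S g" and K: "compact K" "K \<subseteq> S"
    and \<phi>: "Cinf_on UNIV \<phi>" "\<And>x. 0 \<le> \<phi> x" "\<And>x. x \<notin> K \<Longrightarrow> \<phi> x = 0"
    and \<delta>: "0 < \<delta>"
  shows "\<exists>\<gamma>. Cinf_on UNIV \<gamma> \<and>
    (\<integral>\<^sup>+x. ennreal (\<phi> x * \<bar>\<gamma> x - g x\<bar>) \<partial>\<mu>) \<le> ennreal \<delta> \<and>
    (\<integral>\<^sup>+x. ennreal (norm (grad \<phi> x) * \<bar>\<gamma> x - g x\<bar>) \<partial>\<mu>) \<le> ennreal \<delta> \<and>
    (\<integral>\<^sup>+x. ennreal (\<phi> x * norm (grad \<gamma> x)) \<partial>\<mu>)
      \<le> (\<integral>\<^sup>+x. ennreal (\<phi> x) * lip_a g x \<partial>\<mu>) + ennreal \<delta>"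
proof -
  note [measurable_cong] = sets
  have Km[measurable]: "K \<in> sets borel" using K(1) by (simp add: borel_compact)
  have [measurable]: "\<phi> \<in> borel_measurable borel"
    using Cinf_on_continuous[OF \<phi>(1)] by (rule borel_measurable_continuous_onI)
  have grad0: "grad \<phi> x = 0" if "x \<notin> K" for x
    using grad_eq_0_outside[OF compact_imp_closed[OF K(1)], of \<phi>] \<phi>(3) that by blast
  obtain e0 L where e0: "0 < e0" "0 \<le> L"
    and Lip: "\<And>x e. x \<in> K \<Longrightarrow> e \<le> e0 \<Longrightarrow> Lip_const g (ball x e) \<le> ennreal L"
    and ex: "\<And>e. 0 < e \<Longrightarrow> e \<le> e0 \<Longrightarrow> \<exists>\<gamma>. Cinf_on UNIV \<gamma> \<and>
      (\<forall>x\<in>K. \<bar>\<gamma> x - g x\<bar> \<le> L * e \<and> ennreal (norm (grad \<gamma> x)) \<le> Lip_const g (ball x (2 * e)))"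
    using mollify_approx_compact[OF S g K] by metis
  have "bounded (\<phi> ` K)" "bounded (grad \<phi> ` K)"
    using K(1) Cinf_on_continuous[OF \<phi>(1)] Cinf_on_continuous_grad[OF open_UNIV \<phi>(1)]
    by (auto intro!: compact_imp_bounded compact_continuous_image intro: continuous_on_subset)
  then obtain P Q where PQ: "P > 0" "\<And>x. x \<in> K \<Longrightarrow> \<phi> x \<le> P" "Q > 0" "\<And>x. x \<in> K \<Longrightarrow> norm (grad \<phi> x) \<le> Q"
    unfolding bounded_pos by (metis abs_le_D1 imageI real_norm_def)
  define m where "m = measure \<mu> K"
  have m: "emeasure \<mu> K = ennreal m" "0 \<le> m"
    using fin by (auto simp: m_def emeasure_eq_ennreal_measure)
  define I where "I = (\<integral>\<^sup>+x. ennreal (\<phi> x) * lip_a g x \<partial>\<mu>)"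
  define rr where "rr n = inverse (real (Suc n))" for n
  have rr0: "rr \<longlonglongrightarrow> 0" unfolding rr_def by (rule LIMSEQ_inverse_real_of_nat)
  have rrpos: "rr n > 0" for n by (simp add: rr_def)
  define J where "J n = (\<integral>\<^sup>+x. ennreal (\<phi> x) * Lip_const g (ball x (rr n)) \<partial>\<mu>)" for n
  have "\<forall>\<^sub>F n in sequentially. rr n < e0" using rr0 e0(1) by (rule order_tendstoD)
  then obtain N where N: "\<And>n. n \<ge> N \<Longrightarrow> rr n < e0" by (auto simp: eventually_sequentially)
  \<comment> \<open>Dropping \<open>N\<close> terms puts every radius below \<open>e0\<close>, where
    \<open>L\<close> supplies the dominating function.\<close>
  have "(\<lambda>n. J (n + N)) \<longlonglongrightarrow> I"
    unfolding I_def J_def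
  proof (rule nn_integral_dominated_convergence[where w="\<lambda>x. ennreal (P * L) * indicator K x"])
    show "(\<integral>\<^sup>+x. ennreal (P * L) * indicator K x \<partial>\<mu>) < \<infinity>"
      by (simp add: nn_integral_cmult_indicator m ennreal_mult_less_top)
    show "AE x in \<mu>. ennreal (\<phi> x) * Lip_const g (ball x (rr (n + N))) \<le> ennreal (P * L) * indicator K x" for n
    proof (rule AE_I2)
      fix x
      show "ennreal (\<phi> x) * Lip_const g (ball x (rr (n + N))) \<le> ennreal (P * L) * indicator K x"
      proof (cases "x \<in> K")
        case True
        then show ?thesis
          using Lip[OF True, of "rr (n + N)"] N[of "n + N"] PQ(1) e0(2) \<phi>(2)[of x]
          by (auto simp: ennreal_mult intro!: mult_mono ennreal_leI PQ(2))
      qed (simp add: \<phi>(3))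
    qed
    show "AE x in \<mu>. (\<lambda>n. ennreal (\<phi> x) * Lip_const g (ball x (rr (n + N)))) \<longlonglongrightarrow> ennreal (\<phi> x) * lip_a g x"
      using LIMSEQ_ignore_initial_segment[OF Lip_const_LIMSEQ_lip_a[of g]]
      unfolding rr_def by (intro AE_I2 ennreal_tendsto_cmult) auto
  qed measurable
  then have JI: "J \<longlonglongrightarrow> I" by (rule LIMSEQ_offset)
  have evJ: "\<forall>\<^sub>F n in sequentially. J n \<le> I + ennreal \<delta>"
  proof (cases "I = \<infinity>")
    case False
    then have "I < I + ennreal \<delta>" using \<delta> by (cases I) (auto simp: ennreal_less_iff simp flip: ennreal_plus)
    then show ?thesis by (rule eventually_mono[OF order_tendstoD(2)[OF JI] less_imp_le])
  qed auto
  \<comment> \<open>The summand \<open>1\<close> keeps the divisor in \<open>\<delta> / T\<close>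
    positive.\<close>
  define T where "T = max P Q * L * m + 1"
  have T: "T > 0" using PQ e0 m by (simp add: T_def add_nonneg_pos)
  have "\<forall>\<^sub>F n in sequentially. rr n < \<delta> / T"
    using rr0 \<delta> T by (intro order_tendstoD(2)[where y=0]) auto
  moreover have "\<forall>\<^sub>F n in sequentially. rr n < e0" using rr0 e0(1) by (rule order_tendstoD)
  ultimately have "\<forall>\<^sub>F n in sequentially. rr n < \<delta> / T \<and> rr n < e0 \<and> J n \<le> I + ennreal \<delta>"
    using evJ by (intro eventually_conj)
  then obtain n where n: "rr n < \<delta> / T" "rr n < e0" "J n \<le> I + ennreal \<delta>"
    by (auto simp: eventually_sequentially)
  \<comment> \<open>Halved so that the radius \<open>2 * e\<close> of the gradient bound is the
    radius \<open>rr n\<close> in \<open>J n\<close>.\<close>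
  define e where "e = rr n / 2"
  have e: "0 < e" "e \<le> e0" "e \<le> \<delta> / T" using n rrpos[of n] unfolding e_def by linarith+
  obtain \<gamma> where \<gamma>: "Cinf_on UNIV \<gamma>" "\<And>x. x \<in> K \<Longrightarrow> \<bar>\<gamma> x - g x\<bar> \<le> L * e"
      "\<And>x. x \<in> K \<Longrightarrow> ennreal (norm (grad \<gamma> x)) \<le> Lip_const g (ball x (2 * e))"
    using ex[OF e(1,2)] by blast
  \<comment> \<open>A general weight, because both \<open>\<phi>\<close> and the norm of its
    gradient are needed; hence \<open>max P Q\<close>.\<close>
  have small: "(\<integral>\<^sup>+x. ennreal (w x * \<bar>\<gamma> x - g x\<bar>) \<partial>\<mu>) \<le> ennreal \<delta>"
    if w: "\<And>x. 0 \<le> w x" "\<And>x. x \<in> K \<Longrightarrow> w x \<le> max P Q" "\<And>x. x \<notin> K \<Longrightarrow> w x = 0" for w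
  proof -
    have "(\<integral>\<^sup>+x. ennreal (w x * \<bar>\<gamma> x - g x\<bar>) \<partial>\<mu>) \<le> (\<integral>\<^sup>+x. ennreal (max P Q * (L * e)) * indicator K x \<partial>\<mu>)"
    proof (rule nn_integral_mono)
      fix x
      show "ennreal (w x * \<bar>\<gamma> x - g x\<bar>) \<le> ennreal (max P Q * (L * e)) * indicator K x"
      proof (cases "x \<in> K")
        case True
        then show ?thesis
          using PQ(1) by (auto intro!: ennreal_leI mult_mono w \<gamma>(2))
      qed (simp add: w)
    qed
    also have "\<dots> = ennreal (max P Q * (L * e) * m)"
      using PQ(1) e(1) e0(2) m by (simp add: nn_integral_cmult_indicator ennreal_mult)
    also have "max P Q * (L * e) * m \<le> T * e" using e by (simp add: T_def algebra_simps)
    also have "T * e \<le> \<delta>" using e(3) T by (simp add: field_simps)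
    finally show ?thesis by (simp add: ennreal_leI)
  qed
  have "(\<integral>\<^sup>+x. ennreal (\<phi> x * norm (grad \<gamma> x)) \<partial>\<mu>) \<le> J n"
    unfolding J_def
  proof (rule nn_integral_mono)
    fix x
    show "ennreal (\<phi> x * norm (grad \<gamma> x)) \<le> ennreal (\<phi> x) * Lip_const g (ball x (rr n))"
      by (cases "x \<in> K") (use \<gamma>(3)[of x] \<phi>(2,3) in \<open>auto simp: ennreal_mult e_def intro!: mult_left_mono\<close>)
  qed
  also note n(3)
  finally show ?thesis
    unfolding I_def using \<gamma>(1) small[of \<phi>] small[of "\<lambda>x. norm (grad \<phi> x)"] \<phi>(2,3) PQ(2,4) grad0
    by (intro exI[of _ \<gamma>] conjI) (auto simp: le_max_iff_disj)
qed

text \<open>The differences of consecutive cutoffs along a compact exhaustion.\<close>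

lemma smooth_partition_of_unity:
  fixes S :: "'a::euclidean_space set"
  assumes "open S"
  obtains \<phi> :: "nat \<Rightarrow> 'a \<Rightarrow> real" and C
  where "\<And>n. Cinf_on UNIV (\<phi> n)" "\<And>n x. 0 \<le> \<phi> n x" "\<And>n. compact (C n)" "\<And>n. C n \<subseteq> S"
    "\<And>n x. x \<notin> C n \<Longrightarrow> \<phi> n x = 0" "S = (\<Union>n. interior (C n))"
    "\<And>x m. x \<in> C m \<Longrightarrow> (\<Sum>n\<le>Suc m. \<phi> n x) = 1"
    "\<And>x m n. x \<in> C m \<Longrightarrow> Suc m < n \<Longrightarrow> \<phi> n x = 0"
proof -
  obtain C :: "nat \<Rightarrow> 'a set" where C: "\<And>n. compact (C n)" "\<And>n. C n \<subseteq> S"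
      "\<And>n. C n \<subseteq> interior (C (Suc n))" "\<Union>(range C) = S"
    using open_Union_compact_subsets[OF assms] by metis
  have mono: "C m \<subseteq> C n" if "m \<le> n" for m n
    by (rule lift_Suc_mono_le[of C, OF order.trans[OF C(3) interior_subset] that])
  have "\<exists>\<eta>. Cinf_on UNIV \<eta> \<and> (\<forall>x. 0 \<le> \<eta> x \<and> \<eta> x \<le> 1) \<and>
      (\<forall>x\<in>C n. \<eta> x = 1) \<and> (\<forall>x. x \<notin> interior (C (Suc n)) \<longrightarrow> \<eta> x = (0::real))" for n
    using smooth_cutoff[OF C(1) open_interior C(3), of n] by metis
  then obtain \<eta> :: "nat \<Rightarrow> 'a \<Rightarrow> real" where \<eta>: "\<And>n. Cinf_on UNIV (\<eta> n)" "\<And>n x. 0 \<le> \<eta> n x"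
      "\<And>n x. \<eta> n x \<le> 1" "\<And>n x. x \<in> C n \<Longrightarrow> \<eta> n x = 1"
      "\<And>n x. x \<notin> interior (C (Suc n)) \<Longrightarrow> \<eta> n x = 0"
    by metis
  have \<eta>0: "\<eta> n x = 0" if "x \<notin> C (Suc n)" for n x
    using that \<eta>(5) interior_subset by blast
  \<comment> \<open>After the shift \<open>\<theta> n\<close> vanishes outside \<open>C n\<close>,
    and the initial \<open>0\<close> makes the sums of the differences telescope to
    \<open>\<theta> (Suc k)\<close>.\<close>
  define \<theta> where "\<theta> n = (case n of 0 \<Rightarrow> (\<lambda>_. 0) | Suc k \<Rightarrow> \<eta> k)" for n
  have \<theta>: "Cinf_on UNIV (\<theta> n)" "0 \<le> \<theta> n x" "\<theta> n x \<le> 1" "x \<notin> C n \<Longrightarrow> \<theta> n x = 0" for n x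
    using \<eta>(1-3) \<eta>0 by (auto simp: \<theta>_def Cinf_on_const split: nat.split)
  have \<theta>1: "\<theta> n x = 1" if "x \<in> C m" "m < n" for n m x
  proof -
    obtain k where n: "n = Suc k" "m \<le> k" using \<open>m < n\<close> by (cases n) auto
    then have "x \<in> C k" using mono that(1) by blast
    then show ?thesis by (simp add: \<theta>_def n \<eta>(4))
  qed
  define \<phi> where "\<phi> n x = \<theta> (Suc n) x - \<theta> n x" for n x
  show ?thesis
  \<comment> \<open>The exhaustion is shifted because \<open>\<phi> n\<close> contains
    \<open>\<theta> (Suc n)\<close>, which lives on \<open>C (Suc n)\<close>.\<close>
  proof (rule that[of \<phi> "\<lambda>n. C (Suc n)"])
    show "Cinf_on UNIV (\<phi> n)" for n
      unfolding \<phi>_def by (intro Cinf_on_diff \<theta> open_UNIV)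
    show "0 \<le> \<phi> n x" for n x
      using \<theta>1[of x n "Suc n"] \<theta>(2)[of "Suc n" x] \<theta>(3)[of n x] \<theta>(4)[of x n]
      by (cases "x \<in> C n") (auto simp: \<phi>_def)
    show "\<phi> n x = 0" if "x \<notin> C (Suc n)" for n x
      using that mono[of n "Suc n"] \<theta>(4)[of x n] \<theta>(4)[of x "Suc n"] by (auto simp: \<phi>_def)
    have "S \<subseteq> (\<Union>n. interior (C (Suc n)))" using C(3,4) by blast
    moreover have "(\<Union>n. interior (C (Suc n))) \<subseteq> S" using C(2) interior_subset by blast
    ultimately show "S = (\<Union>n. interior (C (Suc n)))" by blast
    show "(\<Sum>n\<le>Suc m. \<phi> n x) = 1" if "x \<in> C (Suc m)" for x m
    proof -
      have "(\<Sum>n\<le>k. \<phi> n x) = \<theta> (Suc k) x" for k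
        by (induction k) (auto simp: \<phi>_def, simp add: \<theta>_def)
      then show ?thesis using \<theta>1[OF that] by simp
    qed
    show "\<phi> n x = 0" if "x \<in> C (Suc m)" "Suc m < n" for x m n
      using that \<theta>1[OF that(1)] by (simp add: \<phi>_def)
  qed (use C in auto)
qed

lemma loc_lipschitz_on_continuous:
  assumes "open S" "loc_lipschitz_on S g"
  shows "continuous_on S g"
proof (intro continuous_at_imp_continuous_on ballI)
  fix x assume "x \<in> S"
  then obtain r L where r: "r > 0" "L-lipschitz_on (ball x r \<inter> S) g"
    using assms(2) unfolding loc_lipschitz_on_def by metis
  have "x \<in> ball x r \<inter> S" using r \<open>x \<in> S\<close> by simp
  then show "isCont g x"
    using lipschitz_on_continuous_on[OF r(2)] continuous_on_eq_continuous_at[of "ball x r \<inter> S" g]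
      assms(1) by (simp add: open_Int)
qed

text \<open>No single mollification scale need work up to the boundary of \<open>S\<close>; each
  piece lives on a compact set and gets its own scale, with errors forming a geometric
  series.\<close>

lemma smooth_approx:
  fixes g :: "'a::euclidean_space \<Rightarrow> real"
  assumes sets: "sets \<mu> = sets borel" and fin: "\<And>K. compact K \<Longrightarrow> emeasure \<mu> K < \<infinity>"
    and S: "open S" and g: "loc_lipschitz_on S g" and \<delta>: "0 < \<delta>"
  obtains h where "Cinf_on S h" "(\<integral>\<^sup>+x\<in>S. ennreal \<bar>h x - g x\<bar> \<partial>\<mu>) \<le> ennreal \<delta>"
    "(\<integral>\<^sup>+x\<in>S. ennreal (norm (grad h x)) \<partial>\<mu>) \<le> (\<integral>\<^sup>+x\<in>S. lip_a g x \<partial>\<mu>) + ennreal \<delta>"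
proof -
  note [measurable_cong] = sets
  have [measurable]: "S \<in> sets borel" using S by simp
  obtain \<phi> :: "nat \<Rightarrow> 'a \<Rightarrow> real" and C
    where \<phi>: "\<And>n. Cinf_on UNIV (\<phi> n)" "\<And>n x. 0 \<le> \<phi> n x"
      and C: "\<And>n. compact (C n)" "\<And>n. C n \<subseteq> S"
      and \<phi>C: "\<And>n x. x \<notin> C n \<Longrightarrow> \<phi> n x = 0" and SC: "S = (\<Union>n. interior (C n))"
      and \<phi>1: "\<And>x m. x \<in> C m \<Longrightarrow> (\<Sum>n\<le>Suc m. \<phi> n x) = 1"
      and \<phi>0: "\<And>x m n. x \<in> C m \<Longrightarrow> Suc m < n \<Longrightarrow> \<phi> n x = 0"
    using smooth_partition_of_unity[OF S] by blast
  have grad0: "grad (\<phi> n) x = 0" if "x \<notin> C n" for n x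
    using grad_eq_0_outside[OF compact_imp_closed[OF C(1)] \<phi>C that] .
  \<comment> \<open>The total is \<open>\<delta> / 2\<close>, since the gradient estimate spends
    \<open>d n\<close> twice on each piece.\<close>
  define d where "d n = (\<delta> / 4) * (1/2) ^ n" for n :: nat
  have d: "0 < d n" for n using \<delta> by (simp add: d_def)
  have "d sums ((\<delta> / 4) * (1 / (1 - 1/2)))"
    unfolding d_def by (intro sums_mult geometric_sums) simp
  then have d_sum: "(\<Sum>n. ennreal (d n)) = ennreal (\<delta> / 2)"
    using d by (intro suminf_ennreal_eq) (auto simp: less_imp_le)
  let ?P = "\<lambda>n \<gamma>. Cinf_on UNIV \<gamma> \<and>
    (\<integral>\<^sup>+x. ennreal (\<phi> n x * \<bar>\<gamma> x - g x\<bar>) \<partial>\<mu>) \<le> ennreal (d n) \<and>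
    (\<integral>\<^sup>+x. ennreal (norm (grad (\<phi> n) x) * \<bar>\<gamma> x - g x\<bar>) \<partial>\<mu>) \<le> ennreal (d n) \<and>
    (\<integral>\<^sup>+x. ennreal (\<phi> n x * norm (grad \<gamma> x)) \<partial>\<mu>)
      \<le> (\<integral>\<^sup>+x. ennreal (\<phi> n x) * lip_a g x \<partial>\<mu>) + ennreal (d n)"
  have "\<forall>n. \<exists>\<gamma>. ?P n \<gamma>"
    using smooth_approx_weighted[OF sets fin S g C(1) C(2) \<phi>(1) \<phi>(2) \<phi>C d] C(1) by blast
  from choice[OF this] obtain \<gamma> where "\<forall>n. ?P n (\<gamma> n)" ..
  then have \<gamma>: "\<And>n. Cinf_on UNIV (\<gamma> n)"
    and L1: "\<And>n. (\<integral>\<^sup>+x. ennreal (\<phi> n x * \<bar>\<gamma> n x - g x\<bar>) \<partial>\<mu>) \<le> ennreal (d n)"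
    and L1': "\<And>n. (\<integral>\<^sup>+x. ennreal (norm (grad (\<phi> n) x) * \<bar>\<gamma> n x - g x\<bar>) \<partial>\<mu>) \<le> ennreal (d n)"
    and gr: "\<And>n. (\<integral>\<^sup>+x. ennreal (\<phi> n x * norm (grad (\<gamma> n) x)) \<partial>\<mu>)
      \<le> (\<integral>\<^sup>+x. ennreal (\<phi> n x) * lip_a g x \<partial>\<mu>) + ennreal (d n)"
    by blast+
  have cont[measurable]: "\<phi> n \<in> borel_measurable borel" "grad (\<phi> n) \<in> borel_measurable borel"
      "\<gamma> n \<in> borel_measurable borel" "grad (\<gamma> n) \<in> borel_measurable borel" for n
    using \<phi>(1)[of n] \<gamma>[of n] by (auto intro!: borel_measurable_continuous_onI intro: Cinf_on_continuous Cinf_on_continuous_grad)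
  \<comment> \<open>\<open>g\<close> is arbitrary outside \<open>S\<close> and may fail to be
    measurable as a total function; the cutoff leaves the weighted integrands unchanged.\<close>
  define g0 where "g0 x = indicator S x *\<^sub>R g x" for x
  have [measurable]: "g0 \<in> borel_measurable borel"
    unfolding g0_def using borel_measurable_continuous_on_indicator[OF _ loc_lipschitz_on_continuous[OF S g]] by simp
  have g0: "\<phi> n x * \<bar>\<gamma> n x - g x\<bar> = \<phi> n x * \<bar>\<gamma> n x - g0 x\<bar>"
      "norm (grad (\<phi> n) x) * \<bar>\<gamma> n x - g x\<bar> = norm (grad (\<phi> n) x) * \<bar>\<gamma> n x - g0 x\<bar>" for n x
    using C(2)[of n] \<phi>C[of x n] grad0[of x n] by (cases "x \<in> C n"; auto simp: g0_def)+

  define h where "h x = (\<Sum>n. \<phi> n x * \<gamma> n x)" for x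
  \<comment> \<open>The gradient of the partial sum that coincides with \<open>h\<close> on
    \<open>C m\<close>.\<close>
  define D where "D m x = (\<Sum>n\<le>Suc m. \<phi> n x *\<^sub>R grad (\<gamma> n) x + \<gamma> n x *\<^sub>R grad (\<phi> n) x)" for m x
  have h: "h x = (\<Sum>n\<le>Suc m. \<phi> n x * \<gamma> n x)" if "x \<in> C m" for x m
    unfolding h_def using \<phi>0[OF that] by (intro suminf_finite) auto
  have int_C: "x \<in> C m" if "x \<in> interior (C m)" for x m
    using that interior_subset by blast
  have G: "GDERIV u x :> grad u x" if "Cinf_on UNIV u" for u and x :: 'a
    using that by (intro GDERIV_grad Cinf_on_differentiable) auto
  have gradh: "grad h x = D m x" if "x \<in> interior (C m)" for x m
  proof (rule grad_eq)
    have "GDERIV (\<lambda>x. \<Sum>n\<le>Suc m. \<phi> n x * \<gamma> n x) x :> D m x"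
      unfolding D_def by (intro GDERIV_sum GDERIV_mult G \<phi> \<gamma>)
    then show "GDERIV h x :> D m x"
      by (rule GDERIV_transform_open[OF _ open_interior that]) (rule h[OF int_C, symmetric])
  qed
  have sum_grad: "(\<Sum>n\<le>Suc m. grad (\<phi> n) x) = 0" if "x \<in> interior (C m)" for x m
  proof (rule GDERIV_unique)
    show "GDERIV (\<lambda>x. \<Sum>n\<le>Suc m. \<phi> n x) x :> (\<Sum>n\<le>Suc m. grad (\<phi> n) x)"
      by (intro GDERIV_sum G \<phi>)
    show "GDERIV (\<lambda>x. \<Sum>n\<le>Suc m. \<phi> n x) x :> 0"
      by (rule GDERIV_transform_open[OF GDERIV_const[of 1] open_interior that]) (simp only: \<phi>1 int_C)
  qed
  \<comment> \<open>Subtracting \<open>g x\<close> times the vanishing sum of gradients turns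
    \<open>\<gamma> n x\<close> into the small \<open>\<gamma> n x - g x\<close>, without
    differentiating \<open>g\<close>.\<close>
  have D_eq: "D m x = (\<Sum>n\<le>Suc m. \<phi> n x *\<^sub>R grad (\<gamma> n) x + (\<gamma> n x - g x) *\<^sub>R grad (\<phi> n) x)"
    if "x \<in> interior (C m)" for x m
  proof -
    have "D m x = D m x - g x *\<^sub>R (\<Sum>n\<le>Suc m. grad (\<phi> n) x)" by (simp only: sum_grad[OF that]) simp
    also have "\<dots> = (\<Sum>n\<le>Suc m. \<phi> n x *\<^sub>R grad (\<gamma> n) x + (\<gamma> n x - g x) *\<^sub>R grad (\<phi> n) x)"
      unfolding D_def scaleR_sum_right sum_subtractf[symmetric] by (intro sum.cong) (auto simp: algebra_simps)
    finally show ?thesis .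
  qed
  \<comment> \<open>The last index depends on the point; the full series is free of it, so that sum
    and integral can be exchanged.\<close>
  have sums_le: "ennreal (\<Sum>n\<le>k. w n) \<le> (\<Sum>n. ennreal (w n))" if "\<And>n. 0 \<le> w n" for w :: "nat \<Rightarrow> real" and k
    using that by (simp flip: sum_ennreal add: sum_le_suminf)
  show ?thesis
  proof (rule that)
    show "Cinf_on S h"
      unfolding Cinf_on_def
    proof (intro allI Ck_on_locally)
      fix k x assume "x \<in> S"
      then obtain m where m: "x \<in> interior (C m)" using SC by blast
      have "Ck_on k UNIV (\<lambda>x. \<Sum>n\<le>Suc m. \<phi> n x * \<gamma> n x)"
        using \<phi>(1) \<gamma> by (intro Ck_on_sum Ck_on_mult open_UNIV) (auto simp: Cinf_on_def)
      then have "Ck_on k (interior (C m)) (\<lambda>x. \<Sum>n\<le>Suc m. \<phi> n x * \<gamma> n x)"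
        by (rule Ck_on_subset) simp
      then have "Ck_on k (interior (C m)) h"
        by (rule Ck_on_cong[OF open_interior, rotated]) (rule h[OF int_C, symmetric])
      then show "\<exists>U. open U \<and> x \<in> U \<and> Ck_on k U h" using m open_interior by blast
    qed

    have "(\<integral>\<^sup>+x\<in>S. ennreal \<bar>h x - g x\<bar> \<partial>\<mu>) \<le> (\<integral>\<^sup>+x. (\<Sum>n. ennreal (\<phi> n x * \<bar>\<gamma> n x - g x\<bar>)) \<partial>\<mu>)"
    proof (rule nn_integral_mono)
      fix x
      show "ennreal \<bar>h x - g x\<bar> * indicator S x \<le> (\<Sum>n. ennreal (\<phi> n x * \<bar>\<gamma> n x - g x\<bar>))"
      proof (cases "x \<in> S")
        case True
        then obtain m where m: "x \<in> C m" using SC int_C by blast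
        have "h x - g x = (\<Sum>n\<le>Suc m. \<phi> n x * \<gamma> n x) - (\<Sum>n\<le>Suc m. \<phi> n x) * g x"
          by (simp only: h[OF m] \<phi>1[OF m] mult_1)
        also have "\<dots> = (\<Sum>n\<le>Suc m. \<phi> n x * (\<gamma> n x - g x))"
          unfolding sum_distrib_right sum_subtractf[symmetric] by (intro sum.cong) (auto simp: algebra_simps)
        finally have "\<bar>h x - g x\<bar> \<le> (\<Sum>n\<le>Suc m. \<phi> n x * \<bar>\<gamma> n x - g x\<bar>)"
          using sum_abs[of "\<lambda>n. \<phi> n x * (\<gamma> n x - g x)" "{..Suc m}"]
          by (simp only: abs_mult abs_of_nonneg[OF \<phi>(2)])
        then have "ennreal \<bar>h x - g x\<bar> \<le> ennreal (\<Sum>n\<le>Suc m. \<phi> n x * \<bar>\<gamma> n x - g x\<bar>)"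
          by (rule ennreal_leI)
        also have "\<dots> \<le> (\<Sum>n. ennreal (\<phi> n x * \<bar>\<gamma> n x - g x\<bar>))"
          using \<phi>(2) by (intro sums_le) simp
        finally show ?thesis using True by simp
      qed simp
    qed
    also have "\<dots> = (\<Sum>n. \<integral>\<^sup>+x. ennreal (\<phi> n x * \<bar>\<gamma> n x - g x\<bar>) \<partial>\<mu>)"
      unfolding g0 by (rule nn_integral_suminf) measurable
    also have "\<dots> \<le> (\<Sum>n. ennreal (d n))" by (intro suminf_le L1 summableI)
    also have "\<dots> \<le> ennreal \<delta>" unfolding d_sum using \<delta> by (intro ennreal_leI) simp
    finally show "(\<integral>\<^sup>+x\<in>S. ennreal \<bar>h x - g x\<bar> \<partial>\<mu>) \<le> ennreal \<delta>" .

    \<comment> \<open>This reassembles the weighted integrals of \<open>lip_a g\<close> into the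
      integral over \<open>S\<close>.\<close>
    have \<phi>sum: "(\<Sum>n. ennreal (\<phi> n x)) = indicator S x" for x
    proof (cases "x \<in> S")
      case True
      then obtain m where m: "x \<in> C m" using SC int_C by blast
      have "(\<Sum>n. ennreal (\<phi> n x)) = (\<Sum>n\<le>Suc m. ennreal (\<phi> n x))"
        using \<phi>0[OF m] by (intro suminf_finite) auto
      also have "\<dots> = ennreal (\<Sum>n\<le>Suc m. \<phi> n x)" using \<phi>(2) by (intro sum_ennreal) auto
      also have "\<dots> = 1" by (simp only: \<phi>1[OF m]) simp
      finally show ?thesis using True by simp
    next
      case False
      then have "\<phi> n x = 0" for n using \<phi>C C(2) by blast
      then show ?thesis using False by simp
    qed
    let ?a = "\<lambda>n x. ennreal (\<phi> n x * norm (grad (\<gamma> n) x))"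
    let ?b = "\<lambda>n x. ennreal (norm (grad (\<phi> n) x) * \<bar>\<gamma> n x - g x\<bar>)"
    have "(\<integral>\<^sup>+x\<in>S. ennreal (norm (grad h x)) \<partial>\<mu>) \<le> (\<integral>\<^sup>+x. (\<Sum>n. ?a n x + ?b n x) \<partial>\<mu>)"
    proof (rule nn_integral_mono)
      fix x
      show "ennreal (norm (grad h x)) * indicator S x \<le> (\<Sum>n. ?a n x + ?b n x)"
      proof (cases "x \<in> S")
        case True
        then obtain m where m: "x \<in> interior (C m)" using SC by blast
        have "norm (grad h x) \<le> (\<Sum>n\<le>Suc m. norm (\<phi> n x *\<^sub>R grad (\<gamma> n) x + (\<gamma> n x - g x) *\<^sub>R grad (\<phi> n) x))"
          unfolding gradh[OF m] D_eq[OF m] by (rule norm_sum)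
        also have "\<dots> \<le> (\<Sum>n\<le>Suc m. \<phi> n x * norm (grad (\<gamma> n) x) + norm (grad (\<phi> n) x) * \<bar>\<gamma> n x - g x\<bar>)"
          using \<phi>(2) by (intro sum_mono order.trans[OF norm_triangle_ineq]) (simp add: mult.commute)
        finally have "ennreal (norm (grad h x)) \<le> ennreal \<dots>" by (rule ennreal_leI)
        also have "\<dots> \<le> (\<Sum>n. ennreal (\<phi> n x * norm (grad (\<gamma> n) x) + norm (grad (\<phi> n) x) * \<bar>\<gamma> n x - g x\<bar>))"
          using \<phi>(2) by (intro sums_le) simp
        also have "\<dots> = (\<Sum>n. ?a n x + ?b n x)" using \<phi>(2) by simp
        finally show ?thesis using True by simp
      qed simp
    qed
    also have "\<dots> = (\<Sum>n. (\<integral>\<^sup>+x. ?a n x \<partial>\<mu>) + (\<integral>\<^sup>+x. ?b n x \<partial>\<mu>))"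
      unfolding g0 by (simp add: nn_integral_suminf nn_integral_add)
    also have "\<dots> \<le> (\<Sum>n. (\<integral>\<^sup>+x. ennreal (\<phi> n x) * lip_a g x \<partial>\<mu>) + ennreal (d n) + ennreal (d n))"
      by (intro suminf_le add_mono gr L1' summableI)
    also have "\<dots> = (\<Sum>n. \<integral>\<^sup>+x. ennreal (\<phi> n x) * lip_a g x \<partial>\<mu>) + (\<Sum>n. ennreal (d n)) + (\<Sum>n. ennreal (d n))"
      by (simp add: suminf_add[OF summableI summableI])
    also have "(\<Sum>n. \<integral>\<^sup>+x. ennreal (\<phi> n x) * lip_a g x \<partial>\<mu>) = (\<integral>\<^sup>+x. (\<Sum>n. ennreal (\<phi> n x) * lip_a g x) \<partial>\<mu>)"
      by (rule nn_integral_suminf[symmetric]) measurable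
    also have "\<dots> = (\<integral>\<^sup>+x\<in>S. lip_a g x \<partial>\<mu>)"
      by (simp add: \<phi>sum mult.commute)
    also have "\<dots> + (\<Sum>n. ennreal (d n)) + (\<Sum>n. ennreal (d n)) = \<dots> + ennreal \<delta>"
      unfolding d_sum add.assoc using \<delta> by (simp flip: ennreal_plus)
    finally show "(\<integral>\<^sup>+x\<in>S. ennreal (norm (grad h x)) \<partial>\<mu>) \<le> (\<integral>\<^sup>+x\<in>S. lip_a g x \<partial>\<mu>) + ennreal \<delta>" .
  qed
qed

section \<open>Equality of the two variations\<close>

text \<open>A smooth competitor is also a locally Lipschitz one, and its \<open>lip_a\<close> is at
  most the norm of its gradient.\<close>

lemma var_Lip_open_le_var_Cinf_open:
  assumes S: "open S"
  shows "var_Lip_open \<mu> f S \<le> var_Cinf_open \<mu> f S"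
  unfolding var_Lip_open_def var_Cinf_open_def
proof (rule INF_mono)
  fix F assume F: "F \<in> {F. (\<forall>n. Cinf_on S (F n) \<and> set_integrable \<mu> S (F n)) \<and> L1_conv_on \<mu> S F f}"
  have "liminf (\<lambda>n. \<integral>\<^sup>+x\<in>S. lip_a (F n) x \<partial>\<mu>)
      \<le> liminf (\<lambda>n. \<integral>\<^sup>+x\<in>S. ennreal (norm (grad (F n) x)) \<partial>\<mu>)"
    using F S lip_a_le_norm_grad
    by (intro Liminf_mono always_eventually allI nn_integral_mono) (auto simp: indicator_def)
  then show "\<exists>F'\<in>{F. (\<forall>n. loc_lipschitz_on S (F n) \<and> set_integrable \<mu> S (F n)) \<and> L1_conv_on \<mu> S F f}.
      liminf (\<lambda>n. \<integral>\<^sup>+x\<in>S. lip_a (F' n) x \<partial>\<mu>)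
      \<le> liminf (\<lambda>n. \<integral>\<^sup>+x\<in>S. ennreal (norm (grad (F n) x)) \<partial>\<mu>)"
    using F S Cinf_on_imp_loc_lipschitz_on by (intro bexI[of _ F]) auto
qed

text \<open>Measurability is available only after restriction to \<open>S\<close>, so the indicator
  is first moved inside the absolute value.\<close>

lemma nn_integral_abs_triangle:
  fixes u v w :: "'a \<Rightarrow> real"
  assumes [measurable]: "S \<in> sets M"
    and u: "set_borel_measurable M S u" and v: "set_borel_measurable M S v"
    and w: "set_borel_measurable M S w"
  shows "(\<integral>\<^sup>+x\<in>S. ennreal \<bar>u x - w x\<bar> \<partial>M)
    \<le> (\<integral>\<^sup>+x\<in>S. ennreal \<bar>u x - v x\<bar> \<partial>M) + (\<integral>\<^sup>+x\<in>S. ennreal \<bar>v x - w x\<bar> \<partial>M)"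
proof -
  note [measurable] = u[unfolded set_borel_measurable_def] v[unfolded set_borel_measurable_def]
    w[unfolded set_borel_measurable_def]
  have eq: "ennreal \<bar>a x - b x\<bar> * indicator S x
      = ennreal \<bar>indicator S x *\<^sub>R a x - indicator S x *\<^sub>R b x\<bar>" for a b :: "'a \<Rightarrow> real" and x
    by (simp add: indicator_def)
  show ?thesis
    unfolding eq
    by (subst nn_integral_add[symmetric])
       (auto intro!: nn_integral_mono simp flip: ennreal_plus simp del: real_scaleR_def intro: ennreal_leI)
qed

text \<open>Each term of a Lipschitz competitor is smoothed with an error
  \<open>\<epsilon> n\<close> tending to zero, which changes neither the L1 limit nor the bound on
  the lower limit of the energies.\<close>

lemma var_Cinf_open_le_var_Lip_open:
  fixes \<mu> :: "'a::euclidean_space measure"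
  assumes sets: "sets \<mu> = sets borel" and fin: "\<And>K. compact K \<Longrightarrow> emeasure \<mu> K < \<infinity>"
    and f: "integrable \<mu> f" and S: "open S"
  shows "var_Cinf_open \<mu> f S \<le> var_Lip_open \<mu> f S"
  unfolding var_Lip_open_def
proof (rule INF_greatest)
  fix F assume "F \<in> {F. (\<forall>n. loc_lipschitz_on S (F n) \<and> set_integrable \<mu> S (F n)) \<and> L1_conv_on \<mu> S F f}"
  then have F: "\<And>n. loc_lipschitz_on S (F n)" "\<And>n. set_integrable \<mu> S (F n)" "L1_conv_on \<mu> S F f"
    by auto
  note [measurable_cong] = sets
  have Sm[measurable]: "S \<in> sets borel" using S by simp
  define \<epsilon> where "\<epsilon> n = inverse (real (Suc n))" for n
  have \<epsilon>: "0 < \<epsilon> n" "\<epsilon> \<longlonglongrightarrow> 0" for n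
    using LIMSEQ_inverse_real_of_nat by (auto simp: \<epsilon>_def[abs_def])
  let ?P = "\<lambda>n h. Cinf_on S h \<and> (\<integral>\<^sup>+x\<in>S. ennreal \<bar>h x - F n x\<bar> \<partial>\<mu>) \<le> ennreal (\<epsilon> n) \<and>
    (\<integral>\<^sup>+x\<in>S. ennreal (norm (grad h x)) \<partial>\<mu>) \<le> (\<integral>\<^sup>+x\<in>S. lip_a (F n) x \<partial>\<mu>) + ennreal (\<epsilon> n)"
  have "\<forall>n. \<exists>h. ?P n h"
  proof
    fix n show "\<exists>h. ?P n h"
      by (rule smooth_approx[OF sets fin S F(1)[of n] \<epsilon>(1)[of n]]) blast+
  qed
  from choice[OF this] obtain H where "\<forall>n. ?P n (H n)" ..
  then have H: "\<And>n. Cinf_on S (H n)"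
      "\<And>n. (\<integral>\<^sup>+x\<in>S. ennreal \<bar>H n x - F n x\<bar> \<partial>\<mu>) \<le> ennreal (\<epsilon> n)"
      "\<And>n. (\<integral>\<^sup>+x\<in>S. ennreal (norm (grad (H n) x)) \<partial>\<mu>) \<le> (\<integral>\<^sup>+x\<in>S. lip_a (F n) x \<partial>\<mu>) + ennreal (\<epsilon> n)"
    by blast+
  have Hm: "set_borel_measurable \<mu> S (H n)" for n
    using borel_measurable_continuous_on_indicator[OF Sm Cinf_on_continuous[OF H(1)]] sets
    by (simp add: set_borel_measurable_def cong: measurable_cong_sets)
  have Fm: "set_borel_measurable \<mu> S (F n)" for n
    using F(2) by (simp add: set_integrable_def set_borel_measurable_def borel_measurable_integrable)
  have fm: "set_borel_measurable \<mu> S f"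
    using f by (auto simp: set_borel_measurable_def)
  have S\<mu>: "S \<in> sets \<mu>" using sets by simp
  have "set_integrable \<mu> S (H n)" for n
  proof -
    have "(\<integral>\<^sup>+x\<in>S. ennreal \<bar>H n x - 0\<bar> \<partial>\<mu>)
        \<le> (\<integral>\<^sup>+x\<in>S. ennreal \<bar>H n x - F n x\<bar> \<partial>\<mu>) + (\<integral>\<^sup>+x\<in>S. ennreal \<bar>F n x - 0\<bar> \<partial>\<mu>)"
      by (rule nn_integral_abs_triangle[OF S\<mu> Hm Fm]) (simp add: set_borel_measurable_def)
    also have "\<dots> < \<infinity>"
    proof -
      have "(\<integral>\<^sup>+x\<in>S. ennreal \<bar>F n x - 0\<bar> \<partial>\<mu>) = (\<integral>\<^sup>+x. ennreal (norm (indicator S x *\<^sub>R F n x)) \<partial>\<mu>)"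
        by (intro nn_integral_cong) (simp add: indicator_def)
      also have "\<dots> < \<infinity>" using F(2)[of n] by (simp add: set_integrable_def integrable_iff_bounded)
      finally show ?thesis using H(2)[of n] by (auto simp: le_less_trans)
    qed
    finally have "(\<integral>\<^sup>+x\<in>S. ennreal \<bar>H n x - 0\<bar> \<partial>\<mu>) < \<infinity>" .
    also have "(\<integral>\<^sup>+x\<in>S. ennreal \<bar>H n x - 0\<bar> \<partial>\<mu>) = (\<integral>\<^sup>+x. ennreal (norm (indicator S x *\<^sub>R H n x)) \<partial>\<mu>)"
      by (intro nn_integral_cong) (simp add: indicator_def)
    finally show ?thesis
      using Hm[of n] by (simp add: set_integrable_def set_borel_measurable_def integrable_iff_bounded)
  qed
  moreover have "L1_conv_on \<mu> S H f"
    unfolding L1_conv_on_def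
  proof (rule tendsto_sandwich[OF _ _ tendsto_const])
    show "\<forall>\<^sub>F n in sequentially. (\<integral>\<^sup>+x\<in>S. ennreal \<bar>H n x - f x\<bar> \<partial>\<mu>)
        \<le> ennreal (\<epsilon> n) + (\<integral>\<^sup>+x\<in>S. ennreal \<bar>F n x - f x\<bar> \<partial>\<mu>)"
      using nn_integral_abs_triangle[OF S\<mu> Hm Fm fm] H(2)
      by (intro always_eventually allI) (meson add_right_mono order_trans)
    have "(\<lambda>n. ennreal (\<epsilon> n) + (\<integral>\<^sup>+x\<in>S. ennreal \<bar>F n x - f x\<bar> \<partial>\<mu>)) \<longlonglongrightarrow> ennreal 0 + 0"
      using F(3) \<epsilon>(2) unfolding L1_conv_on_def by (intro tendsto_add tendsto_ennrealI)
    then show "(\<lambda>n. ennreal (\<epsilon> n) + (\<integral>\<^sup>+x\<in>S. ennreal \<bar>F n x - f x\<bar> \<partial>\<mu>)) \<longlonglongrightarrow> 0" by simp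
  qed auto
  ultimately have "var_Cinf_open \<mu> f S \<le> liminf (\<lambda>n. \<integral>\<^sup>+x\<in>S. ennreal (norm (grad (H n) x)) \<partial>\<mu>)"
    unfolding var_Cinf_open_def using H(1) by (intro INF_lower) auto
  also have "\<dots> \<le> liminf (\<lambda>n. \<integral>\<^sup>+x\<in>S. lip_a (F n) x \<partial>\<mu>)" (is "_ \<le> ?R")
  \<comment> \<open>A fixed slack \<open>e\<close> replaces \<open>\<epsilon> n\<close>, since
    adding a constant commutes with the lower limit.\<close>
  proof (rule ennreal_le_epsilon)
    fix e :: real assume e: "0 < e"
    have "\<forall>\<^sub>F n in sequentially. \<epsilon> n < e" using \<epsilon>(2) e by (rule order_tendstoD)
    then have "\<forall>\<^sub>F n in sequentially. (\<integral>\<^sup>+x\<in>S. ennreal (norm (grad (H n) x)) \<partial>\<mu>)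
        \<le> ennreal e + (\<integral>\<^sup>+x\<in>S. lip_a (F n) x \<partial>\<mu>)"
    proof (rule eventually_mono)
      fix n assume "\<epsilon> n < e"
      then have "ennreal (\<epsilon> n) \<le> ennreal e" by (intro ennreal_leI) simp
      from order_trans[OF H(3)[of n] add_left_mono[OF this]]
      show "(\<integral>\<^sup>+x\<in>S. ennreal (norm (grad (H n) x)) \<partial>\<mu>)
          \<le> ennreal e + (\<integral>\<^sup>+x\<in>S. lip_a (F n) x \<partial>\<mu>)"
        by (simp only: add.commute)
    qed
    then have "liminf (\<lambda>n. \<integral>\<^sup>+x\<in>S. ennreal (norm (grad (H n) x)) \<partial>\<mu>)
        \<le> liminf (\<lambda>n. ennreal e + (\<integral>\<^sup>+x\<in>S. lip_a (F n) x \<partial>\<mu>))"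
      by (rule Liminf_mono)
    also have "\<dots> = ennreal e + ?R"
      by (rule Liminf_const_add) simp
    finally show "liminf (\<lambda>n. \<integral>\<^sup>+x\<in>S. ennreal (norm (grad (H n) x)) \<partial>\<mu>) \<le> ?R + ennreal e"
      by (simp add: add.commute)
  qed
  finally show "var_Cinf_open \<mu> f S \<le> ?R" .
qed

theorem theorem5p3:
  fixes \<mu> :: "(real ^ 'd) measure" and f :: "real ^ 'd \<Rightarrow> real"
  assumes "radon_measure \<mu>" and "f \<in> BV_Lip \<mu>"
  shows "\<forall>B\<in>sets borel. var_Cinf \<mu> f B = var_Lip \<mu> f B"
proof -
  \<comment> \<open>Both extensions are infima over the same open supersets, so agreement on open
    sets suffices.\<close>
  have "var_Cinf_open \<mu> f S = var_Lip_open \<mu> f S" if "open S" for S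
    using that assms
    by (intro antisym var_Lip_open_le_var_Cinf_open var_Cinf_open_le_var_Lip_open)
       (auto simp: radon_measure_def BV_Lip_def)
  then show ?thesis
    unfolding var_Cinf_def var_Lip_def by (auto intro!: INF_cong)
qed

end
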